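(* Let $(V,\varphi,\xi,\eta,g)$ be a $(2n+1)$-dimensional real vector space with almost contact B-metric structure and let $\mathcal T$ be the vector space of all torsion tensors of type $(0,3)$ over $V$, i.e. $(0,3)$-tensors $T$ with $T(x,y,z)=-T(y,x,z)$. The decomposition $$\mathcal T=\mathcal T_1\oplus\mathcal T_2\oplus\cdots\oplus\mathcal T_{15}$$ (with the subspaces $\mathcal T_1,\dots,\mathcal T_{15}$ defined in the context) is orthogonal and invariant with respect to the structure group $\mathcal G\times\mathcal I$.
   Context: An almost contact B-metric structure on $V$ consists of an endomorphism $\varphi$, a vector $\xi$, a 1-form $\eta$ and an inner product $g$ of signature $(n+1,n)$ with $\varphi\xi=0$, $\varphi^2=-I+\eta\otimes\xi$, $\eta\circ\varphi=0$, $\eta(\xi)=1$, $g(\varphi x,\varphi y)=-g(x,y)+\eta(x)\eta(y)$. The structure group $\mathcal G\times\mathcal I$, with $\mathcal G=\mathcal{GL}(n;\mathbb C)\cap\mathcal O(n,n)$ acting on $\ker\eta$ and $\mathcal I$ the identity on $\mathrm{span}(\xi)$, is the group of linear automorphisms of $V$ preserving $\varphi,\xi,\eta,g$. It acts on $\mathcal T$ by $((\lambda a)T)(x,y,z)=T(a^{-1}x,a^{-1}y,a^{-1}z)$. The inner product on $\mathcal T$ is $\langle T',T''\rangle=g^{iq}g^{jr}g^{ks}T'(e_i,e_j,e_k)T''(e_q,e_r,e_s)$ for a basis $\{e_i\}$ of $V$. Torsion forms of $T$: $t(x)=g^{ij}T(x,e_i,e_j)$, $t^*(x)=g^{ij}T(x,e_i,\varphi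 e_j)$, $\hat t(x)=T(x,\xi,\xi)$. Let $\mathfrak S$ denote the cyclic sum over $x,y,z$. Define subspaces of $\mathcal T$ by the following conditions for all $x,y,z\in V$. Tensors with $T(\xi,y,z)=T(x,y,\xi)=0$ and additionally: $\mathcal P_{1,1}$: $T(x,y,z)=-T(\varphi x,\varphi y,z)=-T(x,\varphi y,\varphi z)$; $\mathcal P_{1,2}$: $T(x,y,z)=-T(\varphi x,\varphi y,z)=T(\varphi x,y,\varphi z)$; $\mathcal P_{1,3}$: $T(x,y,z)=T(\varphi x,\varphi y,z)$ and $\mathfrak S\,T(x,y,z)=0$; $\mathcal P_{1,4}$: $T(x,y,z)=T(\varphi x,\varphi y,z)$ and $\mathfrak S\,T(\varphi x,y,z)=0$. Tensors with $T(x,y,z)=\eta(z)T(\varphi^2x,\varphi^2y,\xi)$ and additionally: $\mathcal P_{2,1}$: $T(x,y,\xi)=-T(\varphi x,\varphi y,\xi)$; $\mathcal P_{2,2}$: $T(x,y,\xi)=T(\varphi x,\varphi y,\xi)$. Tensors with $T(x,y,z)=\eta(x)T(\xi,\varphi^2y,\varphi^2z)-\eta(y)T(\xi,\varphi^2x,\varphi^2z)$ and additionally: $\mathcal P_{3,1}$: $T(\xi,y,z)=T(\xi,z,y)=-T(\xi,\varphi y,\varphi z)$; $\mathcal P_{3,2}$: $T(\xi,y,z)=-T(\xi,z,y)=-T(\xi,\varphi y,\varphi z)$; $\mathcal P_{3,3}$: $T(\xi,y,z)=T(\xi,z,y)=T(\xi,\varphi y,\varphi z)$; $\mathcal P_{3,4}$: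 $T(\xi,y,z)=-T(\xi,z,y)=T(\xi,\varphi y,\varphi z)$. $\mathcal P_{4,1}$: $T(x,y,z)=\eta(z)\{\eta(y)\hat t(x)-\eta(x)\hat t(y)\}$. Further, for $i=1,3$ let $\mathcal P_{1,i,2}=\{T\in\mathcal P_{1,i}: t=0\}$ and let $\mathcal P_{1,i,1}$ be the orthogonal complement of $\mathcal P_{1,i,2}$ in $\mathcal P_{1,i}$. Let $\mathcal P_{3,1,3}=\{T\in\mathcal P_{3,1}: t=0,\ t^*=0\}$, and inside the orthogonal complement of $\mathcal P_{3,1,3}$ in $\mathcal P_{3,1}$ let $\mathcal P_{3,1,1}$ be the subspace given by $t^*=0$ and $\mathcal P_{3,1,2}$ the subspace given by $t=0$. Then $\mathcal T_1=\mathcal P_{1,1,1}$, $\mathcal T_2=\mathcal P_{1,1,2}$, $\mathcal T_3=\mathcal P_{1,2}$, $\mathcal T_4=\mathcal P_{1,3,1}$, $\mathcal T_5=\mathcal P_{1,3,2}$, $\mathcal T_6=\mathcal P_{1,4}$, $\mathcal T_7=\mathcal P_{2,1}$, $\mathcal T_8=\mathcal P_{2,2}$, $\mathcal T_9=\mathcal P_{3,1,1}$, $\mathcal T_{10}=\mathcal P_{3,1,2}$, $\mathcal T_{11}=\mathcal P_{3,1,3}$, $\mathcal T_{12}=\mathcal P_{3,2}$, $\mathcal T_{13}=\mathcal P_{3,3}$, $\mathcal T_{14}=\mathcal P_{3,4}$, $\mathcal T_{15}=\mathcal P_{4,1}$. *)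

theory Defs
  imports "HOL-Analysis.Analysis" "HOL-Library.Function_Algebras"
begin

section \<open>Almost contact B-metric structures\<close>

text \<open>An inner product of signature \<open>(p, q)\<close> is in general indefinite: a symmetric bilinear
  form with an orthogonal basis consisting of \<open>p\<close> vectors of square \<open>1\<close> and \<open>q\<close> vectors of
  square \<open>-1\<close>.\<close>

definition inner_product_of_signature ::
    "nat \<Rightarrow> nat \<Rightarrow> ('v::real_vector \<Rightarrow> 'v \<Rightarrow> real) \<Rightarrow> bool" where
  "inner_product_of_signature p q g \<longleftrightarrow>
     (\<forall>x. linear (g x)) \<and> (\<forall>x y. g x y = g y x) \<and>
     (\<exists>P N. finite P \<and> finite N \<and> P \<inter> N = {} \<and> card P = p \<and> card N = q \<and>
        independent (P \<union> N) \<and> span (P \<union> N) = UNIV \<and>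
        (\<forall>u\<in>P. g u u = 1) \<and> (\<forall>u\<in>N. g u u = -1) \<and>
        (\<forall>u\<in>P \<union> N. \<forall>v\<in>P \<union> N. u \<noteq> v \<longrightarrow> g u v = 0))"

locale almost_contact_B_metric =
  fixes n :: nat
    and \<phi> :: "'v::real_vector \<Rightarrow> 'v"
    and \<xi> :: 'v
    and \<eta> :: "'v \<Rightarrow> real"
    and g :: "'v \<Rightarrow> 'v \<Rightarrow> real"
  assumes dim_V: "dim (UNIV :: 'v set) = 2 * n + 1"
    and linear_phi: "linear \<phi>"
    and linear_eta: "linear \<eta>"
    and signature: "inner_product_of_signature (n + 1) n g"
    and phi_xi: "\<phi> \<xi> = 0"
    and phi_phi: "\<phi> (\<phi> x) = - x + \<eta> x *\<^sub>R \<xi>"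
    and eta_phi: "\<eta> (\<phi> x) = 0"
    and eta_xi: "\<eta> \<xi> = 1"
    and g_phi_phi: "g (\<phi> x) (\<phi> y) = - g x y + \<eta> x * \<eta> y"

definition structure_group ::
    "('v::real_vector \<Rightarrow> 'v) \<Rightarrow> 'v \<Rightarrow> ('v \<Rightarrow> real) \<Rightarrow> ('v \<Rightarrow> 'v \<Rightarrow> real) \<Rightarrow> ('v \<Rightarrow> 'v) set" where
  "structure_group \<phi> \<xi> \<eta> g =
     {a. linear a \<and> bij a \<and> (\<forall>x. a (\<phi> x) = \<phi> (a x)) \<and> a \<xi> = \<xi> \<and>
         (\<forall>x. \<eta> (a x) = \<eta> x) \<and> (\<forall>x y. g (a x) (a y) = g x y)}"


section \<open>Torsion tensors\<close>

type_synonym 'v tensor3 = "'v \<Rightarrow> 'v \<Rightarrow> 'v \<Rightarrow> real"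

definition tensor_scale :: "real \<Rightarrow> 'v tensor3 \<Rightarrow> 'v tensor3" where
  "tensor_scale c T = (\<lambda>x y z. c * T x y z)"

global_interpretation tensor: vector_space "tensor_scale :: real \<Rightarrow> 'v tensor3 \<Rightarrow> 'v tensor3"
  by unfold_locales (auto simp: tensor_scale_def fun_eq_iff algebra_simps)

definition torsion_tensors :: "'v::real_vector tensor3 set" where
  "torsion_tensors =
     {T. (\<forall>y z. linear (\<lambda>x. T x y z)) \<and> (\<forall>x z. linear (\<lambda>y. T x y z)) \<and>
         (\<forall>x y. linear (\<lambda>z. T x y z)) \<and> (\<forall>x y z. T x y z = - T y x z)}"

definition group_action :: "('v \<Rightarrow> 'v) \<Rightarrow> 'v tensor3 \<Rightarrow> 'v tensor3" where
  "group_action a T = (\<lambda>x y z. T (inv a x) (inv a y) (inv a z))"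

text \<open>A basis \<open>B\<close> serves as its own index set: \<open>gram_inverse g B u v\<close> is the component
  \<open>g\<^sup>u\<^sup>v\<close> of the matrix inverse to \<open>(g u v)\<close>, for \<open>u, v \<in> B\<close>. For a nondegenerate \<open>g\<close> the values
  on \<open>B\<close> are determined by the condition below; no other values are used.\<close>

definition gram_inverse ::
    "('v \<Rightarrow> 'v \<Rightarrow> real) \<Rightarrow> 'v set \<Rightarrow> 'v \<Rightarrow> 'v \<Rightarrow> real" where
  "gram_inverse g B =
     (SOME h. \<forall>u\<in>B. \<forall>w\<in>B. (\<Sum>v\<in>B. h u v * g v w) = (if u = w then 1 else 0))"

definition tensor_inner ::
    "('v \<Rightarrow> 'v \<Rightarrow> real) \<Rightarrow> 'v set \<Rightarrow> 'v tensor3 \<Rightarrow> 'v tensor3 \<Rightarrow> real" where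
  "tensor_inner g B T' T'' =
     (\<Sum>i\<in>B. \<Sum>j\<in>B. \<Sum>k\<in>B. \<Sum>q\<in>B. \<Sum>r\<in>B. \<Sum>s\<in>B.
        gram_inverse g B i q * gram_inverse g B j r * gram_inverse g B k s *
        T' i j k * T'' q r s)"

definition orthogonal_complement_in ::
    "('v \<Rightarrow> 'v \<Rightarrow> real) \<Rightarrow> 'v set \<Rightarrow> 'v tensor3 set \<Rightarrow> 'v tensor3 set \<Rightarrow> 'v tensor3 set" where
  "orthogonal_complement_in g B W S = {T \<in> W. \<forall>T'\<in>S. tensor_inner g B T T' = 0}"

definition torsion_t ::
    "('v \<Rightarrow> 'v \<Rightarrow> real) \<Rightarrow> 'v set \<Rightarrow> 'v tensor3 \<Rightarrow> 'v \<Rightarrow> real" where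
  "torsion_t g B T x = (\<Sum>i\<in>B. \<Sum>j\<in>B. gram_inverse g B i j * T x i j)"

definition torsion_t_star ::
    "('v \<Rightarrow> 'v) \<Rightarrow> ('v \<Rightarrow> 'v \<Rightarrow> real) \<Rightarrow> 'v set \<Rightarrow> 'v tensor3 \<Rightarrow> 'v \<Rightarrow> real" where
  "torsion_t_star \<phi> g B T x = (\<Sum>i\<in>B. \<Sum>j\<in>B. gram_inverse g B i j * T x i (\<phi> j))"

definition torsion_t_hat :: "'v \<Rightarrow> 'v tensor3 \<Rightarrow> 'v \<Rightarrow> real" where
  "torsion_t_hat \<xi> T x = T x \<xi> \<xi>"


section \<open>The subspaces\<close>

definition P1 :: "'v::real_vector \<Rightarrow> 'v tensor3 set" where
  "P1 \<xi> = {T \<in> torsion_tensors. (\<forall>y z. T \<xi> y z = 0) \<and> (\<forall>x y. T x y \<xi> = 0)}"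

definition P11 :: "('v::real_vector \<Rightarrow> 'v) \<Rightarrow> 'v \<Rightarrow> 'v tensor3 set" where
  "P11 \<phi> \<xi> = {T \<in> P1 \<xi>. \<forall>x y z. T x y z = - T (\<phi> x) (\<phi> y) z \<and>
                                  T x y z = - T x (\<phi> y) (\<phi> z)}"

definition P12 :: "('v::real_vector \<Rightarrow> 'v) \<Rightarrow> 'v \<Rightarrow> 'v tensor3 set" where
  "P12 \<phi> \<xi> = {T \<in> P1 \<xi>. \<forall>x y z. T x y z = - T (\<phi> x) (\<phi> y) z \<and>
                                  T x y z = T (\<phi> x) y (\<phi> z)}"

definition P13 :: "('v::real_vector \<Rightarrow> 'v) \<Rightarrow> 'v \<Rightarrow> 'v tensor3 set" where
  "P13 \<phi> \<xi> = {T \<in> P1 \<xi>. \<forall>x y z. T x y z = T (\<phi> x) (\<phi> y) z \<and>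
                                  T x y z + T y z x + T z x y = 0}"

definition P14 :: "('v::real_vector \<Rightarrow> 'v) \<Rightarrow> 'v \<Rightarrow> 'v tensor3 set" where
  "P14 \<phi> \<xi> = {T \<in> P1 \<xi>. \<forall>x y z. T x y z = T (\<phi> x) (\<phi> y) z \<and>
                                  T (\<phi> x) y z + T (\<phi> y) z x + T (\<phi> z) x y = 0}"

definition P2 :: "('v::real_vector \<Rightarrow> 'v) \<Rightarrow> 'v \<Rightarrow> ('v \<Rightarrow> real) \<Rightarrow> 'v tensor3 set" where
  "P2 \<phi> \<xi> \<eta> = {T \<in> torsion_tensors. \<forall>x y z. T x y z = \<eta> z * T (\<phi> (\<phi> x)) (\<phi> (\<phi> y)) \<xi>}"

definition P21 :: "('v::real_vector \<Rightarrow> 'v) \<Rightarrow> 'v \<Rightarrow> ('v \<Rightarrow> real) \<Rightarrow> 'v tensor3 set" where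
  "P21 \<phi> \<xi> \<eta> = {T \<in> P2 \<phi> \<xi> \<eta>. \<forall>x y. T x y \<xi> = - T (\<phi> x) (\<phi> y) \<xi>}"

definition P22 :: "('v::real_vector \<Rightarrow> 'v) \<Rightarrow> 'v \<Rightarrow> ('v \<Rightarrow> real) \<Rightarrow> 'v tensor3 set" where
  "P22 \<phi> \<xi> \<eta> = {T \<in> P2 \<phi> \<xi> \<eta>. \<forall>x y. T x y \<xi> = T (\<phi> x) (\<phi> y) \<xi>}"

definition P3 :: "('v::real_vector \<Rightarrow> 'v) \<Rightarrow> 'v \<Rightarrow> ('v \<Rightarrow> real) \<Rightarrow> 'v tensor3 set" where
  "P3 \<phi> \<xi> \<eta> = {T \<in> torsion_tensors. \<forall>x y z.
      T x y z = \<eta> x * T \<xi> (\<phi> (\<phi> y)) (\<phi> (\<phi> z)) - \<eta> y * T \<xi> (\<phi> (\<phi> x)) (\<phi> (\<phi> z))}"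

definition P31 :: "('v::real_vector \<Rightarrow> 'v) \<Rightarrow> 'v \<Rightarrow> ('v \<Rightarrow> real) \<Rightarrow> 'v tensor3 set" where
  "P31 \<phi> \<xi> \<eta> = {T \<in> P3 \<phi> \<xi> \<eta>. \<forall>y z. T \<xi> y z = T \<xi> z y \<and> T \<xi> y z = - T \<xi> (\<phi> y) (\<phi> z)}"

definition P32 :: "('v::real_vector \<Rightarrow> 'v) \<Rightarrow> 'v \<Rightarrow> ('v \<Rightarrow> real) \<Rightarrow> 'v tensor3 set" where
  "P32 \<phi> \<xi> \<eta> = {T \<in> P3 \<phi> \<xi> \<eta>. \<forall>y z. T \<xi> y z = - T \<xi> z y \<and> T \<xi> y z = - T \<xi> (\<phi> y) (\<phi> z)}"

definition P33 :: "('v::real_vector \<Rightarrow> 'v) \<Rightarrow> 'v \<Rightarrow> ('v \<Rightarrow> real) \<Rightarrow> 'v tensor3 set" where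
  "P33 \<phi> \<xi> \<eta> = {T \<in> P3 \<phi> \<xi> \<eta>. \<forall>y z. T \<xi> y z = T \<xi> z y \<and> T \<xi> y z = T \<xi> (\<phi> y) (\<phi> z)}"

definition P34 :: "('v::real_vector \<Rightarrow> 'v) \<Rightarrow> 'v \<Rightarrow> ('v \<Rightarrow> real) \<Rightarrow> 'v tensor3 set" where
  "P34 \<phi> \<xi> \<eta> = {T \<in> P3 \<phi> \<xi> \<eta>. \<forall>y z. T \<xi> y z = - T \<xi> z y \<and> T \<xi> y z = T \<xi> (\<phi> y) (\<phi> z)}"

definition P41 :: "'v::real_vector \<Rightarrow> ('v \<Rightarrow> real) \<Rightarrow> 'v tensor3 set" where
  "P41 \<xi> \<eta> = {T \<in> torsion_tensors. \<forall>x y z.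
      T x y z = \<eta> z * (\<eta> y * torsion_t_hat \<xi> T x - \<eta> x * torsion_t_hat \<xi> T y)}"

definition P112 :: "('v::real_vector \<Rightarrow> 'v) \<Rightarrow> 'v \<Rightarrow> ('v \<Rightarrow> 'v \<Rightarrow> real) \<Rightarrow> 'v set \<Rightarrow>
    'v tensor3 set" where
  "P112 \<phi> \<xi> g B = {T \<in> P11 \<phi> \<xi>. \<forall>x. torsion_t g B T x = 0}"

definition P111 :: "('v::real_vector \<Rightarrow> 'v) \<Rightarrow> 'v \<Rightarrow> ('v \<Rightarrow> 'v \<Rightarrow> real) \<Rightarrow> 'v set \<Rightarrow>
    'v tensor3 set" where
  "P111 \<phi> \<xi> g B = orthogonal_complement_in g B (P11 \<phi> \<xi>) (P112 \<phi> \<xi> g B)"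

definition P132 :: "('v::real_vector \<Rightarrow> 'v) \<Rightarrow> 'v \<Rightarrow> ('v \<Rightarrow> 'v \<Rightarrow> real) \<Rightarrow> 'v set \<Rightarrow>
    'v tensor3 set" where
  "P132 \<phi> \<xi> g B = {T \<in> P13 \<phi> \<xi>. \<forall>x. torsion_t g B T x = 0}"

definition P131 :: "('v::real_vector \<Rightarrow> 'v) \<Rightarrow> 'v \<Rightarrow> ('v \<Rightarrow> 'v \<Rightarrow> real) \<Rightarrow> 'v set \<Rightarrow>
    'v tensor3 set" where
  "P131 \<phi> \<xi> g B = orthogonal_complement_in g B (P13 \<phi> \<xi>) (P132 \<phi> \<xi> g B)"

definition P313 :: "('v::real_vector \<Rightarrow> 'v) \<Rightarrow> 'v \<Rightarrow> ('v \<Rightarrow> real) \<Rightarrow> ('v \<Rightarrow> 'v \<Rightarrow> real) \<Rightarrow>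
    'v set \<Rightarrow> 'v tensor3 set" where
  "P313 \<phi> \<xi> \<eta> g B = {T \<in> P31 \<phi> \<xi> \<eta>. (\<forall>x. torsion_t g B T x = 0) \<and>
                                        (\<forall>x. torsion_t_star \<phi> g B T x = 0)}"

definition P311 :: "('v::real_vector \<Rightarrow> 'v) \<Rightarrow> 'v \<Rightarrow> ('v \<Rightarrow> real) \<Rightarrow> ('v \<Rightarrow> 'v \<Rightarrow> real) \<Rightarrow>
    'v set \<Rightarrow> 'v tensor3 set" where
  "P311 \<phi> \<xi> \<eta> g B =
     {T \<in> orthogonal_complement_in g B (P31 \<phi> \<xi> \<eta>) (P313 \<phi> \<xi> \<eta> g B).
        \<forall>x. torsion_t_star \<phi> g B T x = 0}"

definition P312 :: "('v::real_vector \<Rightarrow> 'v) \<Rightarrow> 'v \<Rightarrow> ('v \<Rightarrow> real) \<Rightarrow> ('v \<Rightarrow> 'v \<Rightarrow> real) \<Rightarrow>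
    'v set \<Rightarrow> 'v tensor3 set" where
  "P312 \<phi> \<xi> \<eta> g B =
     {T \<in> orthogonal_complement_in g B (P31 \<phi> \<xi> \<eta>) (P313 \<phi> \<xi> \<eta> g B).
        \<forall>x. torsion_t g B T x = 0}"

text \<open>Numbered from 1; only the indices \<open>1, \<dots>, 15\<close> are meaningful.\<close>

definition torsion_class :: "('v::real_vector \<Rightarrow> 'v) \<Rightarrow> 'v \<Rightarrow> ('v \<Rightarrow> real) \<Rightarrow>
    ('v \<Rightarrow> 'v \<Rightarrow> real) \<Rightarrow> 'v set \<Rightarrow> nat \<Rightarrow> 'v tensor3 set" where
  "torsion_class \<phi> \<xi> \<eta> g B i =
     [P111 \<phi> \<xi> g B, P112 \<phi> \<xi> g B, P12 \<phi> \<xi>, P131 \<phi> \<xi> g B, P132 \<phi> \<xi> g B, P14 \<phi> \<xi>,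
      P21 \<phi> \<xi> \<eta>, P22 \<phi> \<xi> \<eta>,
      P311 \<phi> \<xi> \<eta> g B, P312 \<phi> \<xi> \<eta> g B, P313 \<phi> \<xi> \<eta> g B,
      P32 \<phi> \<xi> \<eta>, P33 \<phi> \<xi> \<eta>, P34 \<phi> \<xi> \<eta>, P41 \<xi> \<eta>] ! (i - 1)"


section \<open>Direct sums of spaces of tensors\<close>

definition is_direct_sum :: "'v tensor3 set \<Rightarrow> 'i set \<Rightarrow> ('i \<Rightarrow> 'v tensor3 set) \<Rightarrow> bool" where
  "is_direct_sum W I S \<longleftrightarrow>
     tensor.subspace W \<and> (\<forall>i\<in>I. tensor.subspace (S i) \<and> S i \<subseteq> W) \<and>
     (\<forall>T\<in>W. \<exists>!U. U \<in> (\<Pi>\<^sub>E i\<in>I. S i) \<and> T = (\<Sum>i\<in>I. U i))"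

end

theory Submission
  imports Defs
begin

text \<open>
  The proof never diagonalizes the indefinite inner product. It rests on two facts: the fifteen classes
  are pairwise orthogonal, and together they span all torsion tensors. Since the inner product is
  nondegenerate on torsion tensors (\<open>inner_nondegenerate\<close>), the sum is then automatically direct
  (\<open>orthogonal_direct_sum\<close>).

  For orthogonality, note that applying \<open>g\<close>-self-adjoint operators to the arguments of a tensor gives a
  self-adjoint operator on tensors, whose eigenspaces for different eigenvalues are orthogonal
  (\<open>eigentensors_orthogonal\<close>). The map \<open>\<phi>\<close> and the projections to \<open>\<xi>\<close> and to \<open>ker \<eta>\<close> are self-adjoint; with
  permutations of arguments they separate all pairs \<open>P\<^sub>i\<^sub>,\<^sub>j\<close> except \<open>P\<^sub>1\<^sub>,\<^sub>3\<close> and \<open>P\<^sub>1\<^sub>,\<^sub>4\<close>. A tensor of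
  the latter two is determined by its complexified values \<open>T(a, b, c)\<close> with \<open>a\<close>, \<open>c\<close> of one type and \<open>b\<close> of the
  conjugate type, which are symmetric, respectively antisymmetric, in \<open>a\<close> and \<open>c\<close>; the real form of the transposition of \<open>a\<close> and
  \<open>c\<close> is the operator \<open>exchange\<close>, with eigenvalues \<open>1\<close> and \<open>-1\<close>. The corresponding eigenprojections also show
  that the \<open>P\<^sub>i\<^sub>,\<^sub>j\<close> span.

  The classes \<open>P\<^sub>1\<^sub>,\<^sub>1\<close>, \<open>P\<^sub>1\<^sub>,\<^sub>3\<close> and \<open>P\<^sub>3\<^sub>,\<^sub>1\<close> are split further by traces. That a subspace and its orthogonal
  complement span is not automatic for an indefinite form, so explicit complements are exhibited: wedge
  products of a covector with \<open>g\<close> and with \<open>g(\<cdot>, \<phi> \<cdot>)\<close> (\<open>P11_span\<close>, \<open>P13_span\<close>, \<open>P31_span\<close>). They are orthogonal to the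
  trace-free tensors, and their own traces are multiples of the covector, with factors
  \<open>2 n - 2\<close>, \<open>2 n\<close> and \<open>\<plusminus> 2 n\<close>; where a factor vanishes, the class is zero for reasons of dimension. The trace
  computation uses that \<open>\<phi>\<close> has trace zero (\<open>trace_phi\<close>).

  Invariance holds because the structure group preserves everything that enters the definitions.
\<close>

section \<open>Traces with respect to a nondegenerate symmetric form\<close>

locale metric_basis =
  fixes g :: "'v::real_vector \<Rightarrow> 'v \<Rightarrow> real" and B :: "'v set"
  assumes linear_form: "linear (g x)"
    and form_sym: "g x y = g y x"
    and nondegenerate: "(\<And>y. g x y = 0) \<Longrightarrow> x = 0"
    and finite_basis: "finite B"
    and independent_basis: "independent B"
    and span_basis: "span B = UNIV"
begin

lemma linear_form_left: "linear (\<lambda>x. g x y)"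
proof -
  have "g y = (\<lambda>x. g x y)" by (auto simp: form_sym)
  then show ?thesis using linear_form[of y] by simp
qed

lemmas form_simps [simp] =
  linear_add[OF linear_form] linear_diff[OF linear_form] linear_neg[OF linear_form]
  linear_scale[OF linear_form] linear_0[OF linear_form]
  linear_add[OF linear_form_left] linear_diff[OF linear_form_left] linear_neg[OF linear_form_left]
  linear_scale[OF linear_form_left] linear_0[OF linear_form_left]

lemmas form_sum = linear_sum[OF linear_form] linear_sum[OF linear_form_left]

lemma basis_expansion: "(\<Sum>b\<in>B. representation B x b *\<^sub>R b) = x"
  by (rule real_vector.sum_representation_eq)
    (use independent_basis span_basis finite_basis in auto)

lemma form_eqI:
  assumes "\<And>w. w \<in> B \<Longrightarrow> g x w = g y w"
  shows "x = y"
proof -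
  have "g (x - y) z = 0" for z
  proof -
    have "g (x - y) z = (\<Sum>b\<in>B. representation B z b * g (x - y) b)"
      by (subst basis_expansion[of z, symmetric]) (simp add: form_sum)
    then show ?thesis using assms by simp
  qed
  then have "x - y = 0" by (rule nondegenerate)
  then show ?thesis by simp
qed

text \<open>The map \<open>x \<mapsto> \<Sum>\<^sub>b g(x, b) b\<close> is injective, since its coefficients determine \<open>x\<close>, hence
  surjective in finite dimension.\<close>

lemma ex_dual_vector:
  obtains d where "\<And>w. w \<in> B \<Longrightarrow> g d w = c w"
proof -
  interpret fd: finite_dimensional_vector_space "scaleR :: real \<Rightarrow> 'v \<Rightarrow> 'v" B
    by unfold_locales (use finite_basis independent_basis span_basis in
      \<open>auto simp: dependent_raw_def span_raw_def\<close>)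
  define F where "F x = (\<Sum>b\<in>B. g x b *\<^sub>R b)" for x
  have lin: "linear F"
    unfolding F_def by (intro linearI) (simp_all add: scaleR_add_left sum.distrib scaleR_sum_right)
  have coeff: "(\<forall>v\<in>B. u v = 0)" if "(\<Sum>v\<in>B. u v *\<^sub>R v) = 0" for u
    using independent_basis finite_basis that real_vector.independent_explicit_finite_subsets by blast
  have "inj F"
  proof (rule injI)
    fix x y assume "F x = F y"
    then have "(\<Sum>b\<in>B. (g x b - g y b) *\<^sub>R b) = 0"
      by (simp add: F_def scaleR_diff_left sum_subtractf)
    from coeff[OF this] show "x = y" by (intro form_eqI) simp
  qed
  then have "surj F"
    using fd.linear_inj_imp_surj lin unfolding linear_def by blast
  then obtain d where d: "F d = (\<Sum>b\<in>B. c b *\<^sub>R b)" by (metis surjD)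
  then have "(\<Sum>b\<in>B. (g d b - c b) *\<^sub>R b) = 0"
    by (simp add: F_def scaleR_diff_left sum_subtractf)
  from coeff[OF this] have "g d w = c w" if "w \<in> B" for w using that by simp
  then show thesis by (rule that)
qed

definition dual :: "'v \<Rightarrow> 'v" where
  "dual u = (\<Sum>v\<in>B. gram_inverse g B u v *\<^sub>R v)"

text \<open>The \<open>SOME\<close> in the definition of the inverse Gram matrix is justified by expanding, in the basis,
  the vector that represents each coordinate functional.\<close>

lemma form_dual:
  assumes "u \<in> B" "w \<in> B"
  shows "g (dual u) w = (if u = w then 1 else 0)"
proof -
  have "\<exists>d. \<forall>w\<in>B. g d w = (if u = w then 1 else 0)" for u :: 'v
    using ex_dual_vector[of "\<lambda>w. if u = w then 1 else 0"] by metis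
  then obtain d where d: "\<And>u w. w \<in> B \<Longrightarrow> g (d u) w = (if u = w then 1 else 0)"
    by metis
  have "\<exists>h. \<forall>u\<in>B. \<forall>w\<in>B. (\<Sum>v\<in>B. h u v * g v w) = (if u = w then 1 else 0)"
  proof (intro exI ballI)
    fix u w assume "u \<in> B" "w \<in> B"
    have "(\<Sum>v\<in>B. representation B (d u) v * g v w) = g (d u) w"
      by (subst (2) basis_expansion[of "d u", symmetric]) (simp add: form_sum)
    then show "(\<Sum>v\<in>B. representation B (d u) v * g v w) = (if u = w then 1 else 0)"
      using d \<open>w \<in> B\<close> by simp
  qed
  from someI_ex[OF this] have
    "\<forall>u\<in>B. \<forall>w\<in>B. (\<Sum>v\<in>B. gram_inverse g B u v * g v w) = (if u = w then 1 else 0)"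
    unfolding gram_inverse_def .
  then show ?thesis using assms by (simp add: dual_def form_sum)
qed

lemma expand_in_dual: "(\<Sum>u\<in>B. g x u *\<^sub>R dual u) = x"
proof (rule form_eqI)
  fix w assume w: "w \<in> B"
  have "g (\<Sum>u\<in>B. g x u *\<^sub>R dual u) w = (\<Sum>u\<in>B. if u = w then g x u else 0)"
    using w by (auto simp: form_sum form_dual intro!: sum.cong)
  then show "g (\<Sum>u\<in>B. g x u *\<^sub>R dual u) w = g x w"
    using w finite_basis by simp
qed

lemma form_dual_representation: "u \<in> B \<Longrightarrow> g x (dual u) = representation B x u"
proof -
  assume u: "u \<in> B"
  have "g x (dual u) = (\<Sum>b\<in>B. representation B x b * g b (dual u))"
    by (subst basis_expansion[of x, symmetric]) (simp add: form_sum)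
  also have "\<dots> = (\<Sum>b\<in>B. if b = u then representation B x b else 0)"
    using u by (intro sum.cong refl) (subst form_sym, auto simp: form_dual)
  finally show ?thesis using u finite_basis by simp
qed

lemma expand_in_basis: "(\<Sum>u\<in>B. g x (dual u) *\<^sub>R u) = x"
  using basis_expansion[of x] by (simp add: form_dual_representation)

lemma expand_linear:
  assumes "linear f"
  shows "(\<Sum>u\<in>B. g x u * f (dual u)) = f x" and "(\<Sum>u\<in>B. g x (dual u) * f u) = (f x :: real)"
proof -
  have "f x = f (\<Sum>u\<in>B. g x u *\<^sub>R dual u)" by (simp only: expand_in_dual)
  then show "(\<Sum>u\<in>B. g x u * f (dual u)) = f x"
    by (simp add: linear_sum[OF assms] linear_scale[OF assms])
  have "f x = f (\<Sum>u\<in>B. g x (dual u) *\<^sub>R u)" by (simp only: expand_in_basis)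
  then show "(\<Sum>u\<in>B. g x (dual u) * f u) = f x"
    by (simp add: linear_sum[OF assms] linear_scale[OF assms])
qed

text \<open>The trace with respect to \<open>g\<close> of a bilinear form; on the form \<open>g(A \<cdot>, \<cdot>)\<close> it is the usual
  trace of the endomorphism \<open>A\<close>.\<close>

definition trace :: "('v \<Rightarrow> 'v \<Rightarrow> real) \<Rightarrow> real" where
  "trace b = (\<Sum>u\<in>B. b u (dual u))"

text \<open>The matrix of the components \<open>g(dual u, dual v)\<close> is symmetric, so it makes no difference which
  argument of \<open>b\<close> receives the dual basis.\<close>

lemma trace_flip:
  assumes "\<And>x. linear (b x)" "\<And>y. linear (\<lambda>x. b x y)"
  shows "trace (\<lambda>x y. b y x) = trace b"
proof -
  have "trace b = (\<Sum>u\<in>B. \<Sum>v\<in>B. g (dual u) (dual v) * b u v)"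
    unfolding trace_def by (intro sum.cong refl) (simp add: expand_linear[OF assms(1)])
  also have "\<dots> = (\<Sum>v\<in>B. \<Sum>u\<in>B. g (dual v) (dual u) * b u v)"
    by (subst sum.swap) (simp add: form_sym[of "dual _" "dual _"])
  also have "\<dots> = (\<Sum>v\<in>B. b (dual v) v)"
    by (intro sum.cong refl) (simp add: expand_linear(2)[OF assms(2)])
  finally show ?thesis by (simp add: trace_def)
qed

text \<open>An operator inside a contraction moves to the other argument as its adjoint. All
  self-adjointness and invariance statements about contractions reduce to this one.\<close>

lemma trace_adjoint:
  assumes "\<And>x. linear (b x)" "\<And>y. linear (\<lambda>x. b x y)"
    and adj: "\<And>x y. g (A x) y = g x (A' y)"
  shows "trace (\<lambda>x y. b (A x) y) = trace (\<lambda>x y. b x (A' y))"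
proof -
  have "trace (\<lambda>x y. b (A x) y) = (\<Sum>u\<in>B. \<Sum>v\<in>B. g (A u) (dual v) * b v (dual u))"
    unfolding trace_def by (intro sum.cong refl) (simp add: expand_linear(2)[OF assms(2)])
  also have "\<dots> = (\<Sum>v\<in>B. \<Sum>u\<in>B. g (A' (dual v)) u * b v (dual u))"
    by (subst sum.swap) (simp add: adj form_sym[of "A' _"])
  also have "\<dots> = trace (\<lambda>x y. b x (A' y))"
    unfolding trace_def by (intro sum.cong refl) (simp add: expand_linear(1)[OF assms(1)])
  finally show ?thesis .
qed

lemma trace_form: "trace g = card B"
proof -
  have "trace g = (\<Sum>u\<in>B. 1)"
    unfolding trace_def by (intro sum.cong refl) (metis form_dual form_sym)
  then show ?thesis by simp
qed

lemma trace_endomorphism: "trace (\<lambda>x y. g (A x) y) = (\<Sum>u\<in>B. representation B (A u) u)"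
  unfolding trace_def by (intro sum.cong refl) (simp add: form_dual_representation)

lemma trace_diff: "trace (\<lambda>x y. b x y - c x y) = trace b - trace c"
  by (simp add: trace_def sum_subtractf)

lemma trace_minus: "trace (\<lambda>x y. - b x y) = - trace b"
  by (simp add: trace_def sum_negf)

lemma trace_scale: "trace (\<lambda>x y. k * b x y) = k * trace b"
  by (simp add: trace_def sum_distrib_left)

lemma trace_product: "linear f \<Longrightarrow> trace (\<lambda>x y. g u x * f y) = f u"
  by (simp add: trace_def expand_linear)

end

section \<open>Tensors and their inner product\<close>

definition trilinear :: "'v::real_vector tensor3 \<Rightarrow> bool" where
  "trilinear T \<longleftrightarrow> (\<forall>y z. linear (\<lambda>x. T x y z)) \<and> (\<forall>x z. linear (\<lambda>y. T x y z)) \<and>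
     (\<forall>x y. linear (\<lambda>z. T x y z))"

lemma torsion_tensors_iff:
  "T \<in> torsion_tensors \<longleftrightarrow> trilinear T \<and> (\<forall>x y z. T x y z = - T y x z)"
  by (auto simp: torsion_tensors_def trilinear_def)

lemma trilinear_linear:
  assumes "trilinear T"
  shows "linear (\<lambda>x. T x y z)" "linear (\<lambda>y. T x y z)" "linear (\<lambda>z. T x y z)" "linear (T x y)"
  using assms by (auto simp: trilinear_def)

lemma trilinear_simps:
  assumes "trilinear T"
  shows "T (x + x') y z = T x y z + T x' y z" "T x (y + y') z = T x y z + T x y' z"
    "T x y (z + z') = T x y z + T x y z'"
    "T (x - x') y z = T x y z - T x' y z" "T x (y - y') z = T x y z - T x y' z"
    "T x y (z - z') = T x y z - T x y z'"
    "T (- x) y z = - T x y z" "T x (- y) z = - T x y z" "T x y (- z) = - T x y z"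
    "T (c *\<^sub>R x) y z = c * T x y z" "T x (c *\<^sub>R y) z = c * T x y z"
    "T x y (c *\<^sub>R z) = c * T x y z"
    "T 0 y z = 0" "T x 0 z = 0" "T x y 0 = 0"
  using linear_add[OF trilinear_linear(1)[OF assms]] linear_add[OF trilinear_linear(2)[OF assms]]
    linear_add[OF trilinear_linear(3)[OF assms]]
    linear_diff[OF trilinear_linear(1)[OF assms]] linear_diff[OF trilinear_linear(2)[OF assms]]
    linear_diff[OF trilinear_linear(3)[OF assms]]
    linear_neg[OF trilinear_linear(1)[OF assms]] linear_neg[OF trilinear_linear(2)[OF assms]]
    linear_neg[OF trilinear_linear(3)[OF assms]]
    linear_scale[OF trilinear_linear(1)[OF assms]] linear_scale[OF trilinear_linear(2)[OF assms]]
    linear_scale[OF trilinear_linear(3)[OF assms]]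
    linear_0[OF trilinear_linear(1)[OF assms]] linear_0[OF trilinear_linear(2)[OF assms]]
    linear_0[OF trilinear_linear(3)[OF assms]]
  by (simp_all add: o_def)

lemma trilinearI:
  assumes "\<And>x x' y z. T (x + x') y z = T x y z + T x' y z"
    "\<And>x y y' z. T x (y + y') z = T x y z + T x y' z"
    "\<And>x y z z'. T x y (z + z') = T x y z + T x y z'"
    "\<And>c x y z. T (c *\<^sub>R x) y z = c * T x y z" "\<And>c x y z. T x (c *\<^sub>R y) z = c * T x y z"
    "\<And>c x y z. T x y (c *\<^sub>R z) = c * T x y z"
  shows "trilinear T"
  unfolding trilinear_def by (intro conjI allI linearI) (simp_all add: assms)

lemma trilinear_slots:
  assumes "trilinear T" "linear A" "linear C" "linear D"
  shows "trilinear (\<lambda>x y z. T (A x) (C y) (D z))"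
  by (rule trilinearI)
    (simp_all add: trilinear_simps[OF assms(1)] linear_add[OF assms(2)] linear_add[OF assms(3)]
      linear_add[OF assms(4)] linear_scale[OF assms(2)] linear_scale[OF assms(3)]
      linear_scale[OF assms(4)])

lemma trilinear_swap:
  assumes "trilinear T"
  shows "trilinear (\<lambda>x y z. T y x z)" "trilinear (\<lambda>x y z. T z y x)" "trilinear (\<lambda>x y z. T x z y)"
  using assms by (auto simp: trilinear_def)

lemma tensor_apply [simp]: "tensor_scale c T x y z = c * T x y z"
  by (simp add: tensor_scale_def)

text \<open>The spaces of tensors below are cut out by equations between such functionals, so that they are
  subspaces by \<open>subspace_conditions\<close>, without a separate computation for each of them.\<close>

definition tensor_functional :: "('v tensor3 \<Rightarrow> real) \<Rightarrow> bool" where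
  "tensor_functional F \<longleftrightarrow>
     (\<forall>S T. F (S + T) = F S + F T) \<and> (\<forall>c T. F (tensor_scale c T) = c * F T)"

lemma tensor_functionalD:
  assumes "tensor_functional F"
  shows "F (S + T) = F S + F T" "F (tensor_scale c T) = c * F T"
    "F 0 = 0" "F (S - T) = F S - F T" "F (- T) = - F T"
proof -
  show *: "F (S + T) = F S + F T" "F (tensor_scale c T) = c * F T" for S T c
    using assms by (auto simp: tensor_functional_def)
  show "F 0 = 0" using *(1)[of 0 0] by simp
  have neg: "F (- T) = - F T" for T
  proof -
    have "- T = tensor_scale (-1) T" by (simp add: fun_eq_iff)
    then show ?thesis using *(2)[of "-1" T] by simp
  qed
  then show "F (- T) = - F T" .
  show "F (S - T) = F S - F T" using *(1)[of S "- T"] neg[of T] by simp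
qed

lemma tensor_functional_sum:
  assumes "tensor_functional F"
  shows "F (\<Sum>i\<in>I. U i) = (\<Sum>i\<in>I. F (U i))"
  by (induction I rule: infinite_finite_induct)
    (simp_all only: sum.infinite sum.empty sum.insert tensor_functionalD[OF assms] not_False_eq_True)

lemma tensor_functional_intros:
  "tensor_functional (\<lambda>T. T x y z)"
  "tensor_functional (\<lambda>T. 0)"
  "tensor_functional F \<Longrightarrow> tensor_functional (\<lambda>T. - F T)"
  "tensor_functional F \<Longrightarrow> tensor_functional (\<lambda>T. c * F T)"
  "tensor_functional F \<Longrightarrow> tensor_functional G \<Longrightarrow> tensor_functional (\<lambda>T. F T + G T)"
  "tensor_functional F \<Longrightarrow> tensor_functional G \<Longrightarrow> tensor_functional (\<lambda>T. F T - G T)"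
  "(\<And>i. i \<in> I \<Longrightarrow> tensor_functional (H i)) \<Longrightarrow> tensor_functional (\<lambda>T. \<Sum>i\<in>I. H i T)"
  by (simp_all add: tensor_functional_def algebra_simps sum.distrib sum_distrib_left)

lemma subspace_conditions:
  "tensor.subspace {T. P T} \<Longrightarrow> tensor.subspace {T. Q T} \<Longrightarrow> tensor.subspace {T. P T \<and> Q T}"
  "(\<And>x. tensor.subspace {T. R x T}) \<Longrightarrow> tensor.subspace {T. \<forall>x. R x T}"
  "(\<And>x. x \<in> X \<Longrightarrow> tensor.subspace {T. R x T}) \<Longrightarrow> tensor.subspace {T. \<forall>x\<in>X. R x T}"
  "tensor_functional F \<Longrightarrow> tensor_functional G \<Longrightarrow> tensor.subspace {T. F T = G T}"
  "tensor.subspace W \<Longrightarrow> tensor.subspace {T. T \<in> W}"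
  by (auto simp: tensor.subspace_def tensor_functionalD)

lemma linear_real_iff: "linear (f :: 'v::real_vector \<Rightarrow> real) \<longleftrightarrow>
  (\<forall>x y. f (x + y) = f x + f y) \<and> (\<forall>c x. f (c *\<^sub>R x) = c * f x)"
  by (simp add: linear_iff)

lemma subspace_torsion_tensors: "tensor.subspace torsion_tensors"
  unfolding torsion_tensors_def linear_real_iff
  by (intro subspace_conditions tensor_functional_intros)

lemma tensor_functional_inner:
  "tensor_functional (\<lambda>S. tensor_inner g B S T)" "tensor_functional (\<lambda>T. tensor_inner g B S T)"
proof -
  have eq: "tensor_inner g B S T = (\<Sum>i\<in>B. \<Sum>j\<in>B. \<Sum>k\<in>B. \<Sum>q\<in>B. \<Sum>r\<in>B. \<Sum>s\<in>B.
        (gram_inverse g B i q * gram_inverse g B j r * gram_inverse g B k s * T q r s) * S i j k)"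
    for S T by (simp add: tensor_inner_def ac_simps)
  show "tensor_functional (\<lambda>S. tensor_inner g B S T)"
    unfolding eq by (intro tensor_functional_intros)
  show "tensor_functional (\<lambda>T. tensor_inner g B S T)"
    unfolding tensor_inner_def by (intro tensor_functional_intros)
qed

lemmas inner_simps =
  tensor_functionalD[OF tensor_functional_inner(1)] tensor_functionalD[OF tensor_functional_inner(2)]

lemma tensor_functional_torsion_t:
  "tensor_functional (\<lambda>T. torsion_t g B T x)" "tensor_functional (\<lambda>T. torsion_t_star \<phi> g B T x)"
  unfolding torsion_t_def torsion_t_star_def by (intro tensor_functional_intros)+

lemma subspace_orthogonal_complement:
  assumes "tensor.subspace W"
  shows "tensor.subspace (orthogonal_complement_in g B W S)"
  unfolding orthogonal_complement_in_def
  by (intro subspace_conditions tensor_functional_inner tensor_functional_intros assms)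

context metric_basis
begin

lemma linear_trace:
  assumes "\<And>u v. linear (\<lambda>x. b x u v)"
  shows "linear (\<lambda>x. trace (b x))"
  unfolding trace_def by (intro linear_compose_sum ballI assms)

lemma torsion_t_trace: "trilinear T \<Longrightarrow> torsion_t g B T x = trace (T x)"
  unfolding torsion_t_def trace_def dual_def
  by (intro sum.cong refl) (simp add: linear_sum[OF trilinear_linear(4)] trilinear_simps)

text \<open>Writing the inner product as an iterated trace makes the adjoint rule available in each of the
  three arguments separately.\<close>

lemma inner_trace:
  assumes "trilinear T"
  shows "tensor_inner g B S T =
    trace (\<lambda>x x'. trace (\<lambda>y y'. trace (\<lambda>z z'. S x y z * T x' y' z')))"
proof -
  have "T (dual i) (dual j) (dual k) = (\<Sum>q\<in>B. \<Sum>r\<in>B. \<Sum>s\<in>B.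
      gram_inverse g B i q * gram_inverse g B j r * gram_inverse g B k s * T q r s)" for i j k
    unfolding dual_def
    by (subst linear_sum[OF trilinear_linear(1)[OF assms]], rule sum.cong, rule refl,
        simp only: trilinear_simps[OF assms],
        subst linear_sum[OF trilinear_linear(2)[OF assms]], subst sum_distrib_left,
        rule sum.cong, rule refl, simp only: trilinear_simps[OF assms],
        subst linear_sum[OF trilinear_linear(3)[OF assms]], simp only: sum_distrib_left,
        rule sum.cong, rule refl, simp only: trilinear_simps[OF assms] ac_simps)
  then show ?thesis
    unfolding tensor_inner_def trace_def by (simp add: sum_distrib_left ac_simps)
qed

lemmas inner_components = inner_trace[unfolded trace_def]

lemma inner_commute:
  assumes "trilinear S" "trilinear T"
  shows "tensor_inner g B S T = tensor_inner g B T S"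
proof -
  have 1: "trace (\<lambda>z z'. S x y z * T x' y' z') = trace (\<lambda>z z'. T x' y' z * S x y z')"
    for x y x' y'
  proof -
    have "trace (\<lambda>z z'. T x' y' z' * S x y z) = trace (\<lambda>z z'. T x' y' z * S x y z')"
      by (rule trace_flip) (simp_all add: linear_iff trilinear_simps[OF assms(1)]
          trilinear_simps[OF assms(2)] algebra_simps)
    then show ?thesis by (simp add: mult.commute)
  qed
  have lin: "linear (\<lambda>x. trace (\<lambda>z z'. T x y z * S u v z'))"
    "linear (\<lambda>y. trace (\<lambda>z z'. T x y z * S u v z'))"
    "linear (\<lambda>u. trace (\<lambda>z z'. T x y z * S u v z'))"
    "linear (\<lambda>v. trace (\<lambda>z z'. T x y z * S u v z'))" for x y u v
    by (rule linear_trace, simp add: linear_iff trilinear_simps[OF assms(1)]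
        trilinear_simps[OF assms(2)] algebra_simps)+
  have 2: "trace (\<lambda>y y'. trace (\<lambda>z z'. T x' y' z * S x y z')) =
      trace (\<lambda>y y'. trace (\<lambda>z z'. T x' y z * S x y' z'))" for x x'
    using trace_flip[of "\<lambda>y y'. trace (\<lambda>z z'. T x' y z * S x y' z')"] lin by simp
  have 3: "trace (\<lambda>x x'. trace (\<lambda>y y'. trace (\<lambda>z z'. T x' y z * S x y' z'))) =
      trace (\<lambda>x x'. trace (\<lambda>y y'. trace (\<lambda>z z'. T x y z * S x' y' z')))"
    using trace_flip[of "\<lambda>x x'. trace (\<lambda>y y'. trace (\<lambda>z z'. T x y z * S x' y' z'))"]
    by (simp add: linear_trace lin)
  show ?thesis
    by (simp add: inner_trace assms 1 2 3)
qed

lemma inner_slots: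
  assumes S: "trilinear S" and T: "trilinear T" and lin: "linear A'" "linear C'" "linear D'"
    and adj: "\<And>x y. g (A x) y = g x (A' y)" "\<And>x y. g (C x) y = g x (C' y)"
      "\<And>x y. g (D x) y = g x (D' y)"
  shows "tensor_inner g B (\<lambda>x y z. S (A x) (C y) (D z)) T =
    tensor_inner g B S (\<lambda>x y z. T (A' x) (C' y) (D' z))"
proof -
  have 1: "trace (\<lambda>z z'. S x y (D z) * T x' y' z') = trace (\<lambda>z z'. S x y z * T x' y' (D' z'))"
    for x y x' y'
    by (rule trace_adjoint[of "\<lambda>z z'. S x y z * T x' y' z'"])
      (simp_all add: adj linear_iff trilinear_simps[OF S] trilinear_simps[OF T] algebra_simps)
  have l: "linear (\<lambda>x. trace (\<lambda>z z'. S x y z * T u v (D' z')))"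
    "linear (\<lambda>y. trace (\<lambda>z z'. S x y z * T u v (D' z')))"
    "linear (\<lambda>u. trace (\<lambda>z z'. S x y z * T u v (D' z')))"
    "linear (\<lambda>v. trace (\<lambda>z z'. S x y z * T u v (D' z')))" for x y u v
    by (rule linear_trace, simp add: linear_iff trilinear_simps[OF S]
        trilinear_simps[OF T] algebra_simps)+
  have 2: "trace (\<lambda>y y'. trace (\<lambda>z z'. S x (C y) z * T x' y' (D' z'))) =
      trace (\<lambda>y y'. trace (\<lambda>z z'. S x y z * T x' (C' y') (D' z')))" for x x'
    by (rule trace_adjoint[of "\<lambda>y y'. trace (\<lambda>z z'. S x y z * T x' y' (D' z'))"])
      (simp_all add: adj l)
  have l2: "linear (\<lambda>u. trace (\<lambda>z z'. S x y z * T u (C' v) (D' z')))" for x y v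
    by (rule l)
  have 3: "trace (\<lambda>x x'. trace (\<lambda>y y'. trace (\<lambda>z z'. S (A x) y z * T x' (C' y') (D' z')))) =
      trace (\<lambda>x x'. trace (\<lambda>y y'. trace (\<lambda>z z'. S x y z * T (A' x') (C' y') (D' z'))))"
    by (rule trace_adjoint[of
        "\<lambda>x x'. trace (\<lambda>y y'. trace (\<lambda>z z'. S x y z * T x' (C' y') (D' z')))"])
      (simp_all add: adj l linear_trace)
  show ?thesis
    by (simp add: inner_trace T trilinear_slots lin 1 2 3)
qed

lemma inner_swap:
  assumes "trilinear T"
  shows "tensor_inner g B (\<lambda>x y z. S y x z) (\<lambda>x y z. T y x z) = tensor_inner g B S T"
    "tensor_inner g B (\<lambda>x y z. S x z y) (\<lambda>x y z. T x z y) = tensor_inner g B S T"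
    "tensor_inner g B (\<lambda>x y z. S z y x) (\<lambda>x y z. T z y x) = tensor_inner g B S T"
proof -
  have 1: "tensor_inner g B (\<lambda>x y z. S y x z) (\<lambda>x y z. T y x z) = tensor_inner g B S T"
    if "trilinear T" for S T
    unfolding inner_components[OF that] inner_components[OF trilinear_swap(1)[OF that]]
    by (rule sum.swap)
  have 2: "tensor_inner g B (\<lambda>x y z. S x z y) (\<lambda>x y z. T x z y) = tensor_inner g B S T"
    if "trilinear T" for S T
    unfolding inner_components[OF that] inner_components[OF trilinear_swap(3)[OF that]]
    by (intro sum.cong refl sum.swap)
  show "tensor_inner g B (\<lambda>x y z. S y x z) (\<lambda>x y z. T y x z) = tensor_inner g B S T"
    "tensor_inner g B (\<lambda>x y z. S x z y) (\<lambda>x y z. T x z y) = tensor_inner g B S T"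
    by (rule 1[OF assms], rule 2[OF assms])
  show "tensor_inner g B (\<lambda>x y z. S z y x) (\<lambda>x y z. T z y x) = tensor_inner g B S T"
    by (rule trans[OF 1[of "\<lambda>x y z. T z x y" "\<lambda>x y z. S z x y"]
          trans[OF 2[of "\<lambda>x y z. T y x z" "\<lambda>x y z. S y x z"] 1[OF assms]]])
      (use assms in \<open>auto simp: trilinear_def\<close>)
qed

lemma torsion_antisym: "T \<in> torsion_tensors \<Longrightarrow> T y x z = - T x y z"
  unfolding torsion_tensors_def by blast

text \<open>Pairing with a decomposable tensor is a contraction: \<open>g(u, \<cdot>)\<close> inserts \<open>u\<close>, and the form \<open>g(\<cdot>, C \<cdot>)\<close>
  takes a trace.\<close>

lemma inner_contraction:
  assumes S: "trilinear S" and C: "linear C" and adj: "\<And>x y. g (C x) y = g x (C y)"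
  shows "tensor_inner g B S (\<lambda>x y z. g u x * g y (C z)) = trace (\<lambda>y y'. S u y (C y'))"
proof -
  have tri: "trilinear (\<lambda>x y z. g u x * g y (C z))"
    by (rule trilinearI) (simp_all add: linear_add[OF C] linear_scale[OF C] algebra_simps)
  have 1: "trace (\<lambda>z z'. S x y z * (g u x' * g y' (C z'))) = g u x' * S x y (C y')" for x x' y y'
  proof -
    have "trace (\<lambda>z z'. S x y z * (g u x' * g y' (C z'))) =
        g u x' * (\<Sum>k\<in>B. g (C y') (dual k) * S x y k)"
      by (simp add: trace_def sum_distrib_left adj ac_simps)
    then show ?thesis by (simp add: expand_linear(2)[OF trilinear_linear(4)[OF S]])
  qed
  have 2: "trace (\<lambda>y y'. g u x' * S x y (C y')) = g u x' * trace (\<lambda>y y'. S x y (C y'))" for x x'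
    by (rule trace_scale)
  have "linear (\<lambda>x. trace (\<lambda>y y'. S x y (C y')))"
    by (intro linear_trace trilinear_linear[OF S])
  from expand_linear(2)[OF this, of u] show ?thesis
    by (subst inner_trace[OF tri]) (simp add: 1 2 trace_def[of "\<lambda>x x'. g u x' * _ x"])
qed

text \<open>Both halves of the antisymmetrization contribute equally, since the inner product is invariant
  under permutations of the arguments.\<close>

lemma inner_antisym:
  assumes S: "S \<in> torsion_tensors" and T: "trilinear T"
  shows "tensor_inner g B S (\<lambda>x y z. T x y z - T y x z) = 2 * tensor_inner g B S T"
proof -
  have "(\<lambda>x y z. T x y z - T y x z) = T - (\<lambda>x y z. T y x z)" by (simp add: fun_eq_iff)
  moreover have "(\<lambda>x y z. S y x z) = - S"
    by (intro ext) (subst torsion_antisym[OF S], simp)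
  then have "tensor_inner g B S (\<lambda>x y z. T y x z) = - tensor_inner g B S T"
    using inner_swap(1)[OF trilinear_swap(1)[OF T], of S] by (simp add: inner_simps)
  ultimately show ?thesis by (simp add: inner_simps)
qed

text \<open>The antisymmetrized products \<open>g(u, x) g(v, y) g(w, z)\<close> are torsion tensors, and pairing with them
  gives twice the value of \<open>T\<close> at \<open>u\<close>, \<open>v\<close>, \<open>w\<close>.\<close>

lemma inner_nondegenerate:
  assumes T: "T \<in> torsion_tensors" and orth: "\<And>S. S \<in> torsion_tensors \<Longrightarrow> tensor_inner g B T S = 0"
  shows "T = 0"
proof -
  have triT: "trilinear T" using T by (simp add: torsion_tensors_iff)
  have "T u v w = 0" for u v w
  proof -
    let ?E = "\<lambda>x y z. g u x * g v y * g w z"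
    have tri: "trilinear ?E" by (rule trilinearI) (simp_all add: algebra_simps)
    have "(\<lambda>x y z. ?E x y z - ?E y x z) \<in> torsion_tensors"
      unfolding torsion_tensors_iff
      by (intro conjI trilinearI) (simp_all add: algebra_simps)
    from orth[OF this] have "tensor_inner g B T ?E = 0"
      by (simp add: inner_antisym[OF T tri])
    moreover have "tensor_inner g B T ?E = T u v w"
    proof -
      have "tensor_inner g B T ?E = (\<Sum>i\<in>B. g u (dual i) * (\<Sum>j\<in>B. g v (dual j) *
          (\<Sum>k\<in>B. g w (dual k) * T i j k)))"
        unfolding inner_components[OF tri] by (simp add: sum_distrib_left ac_simps)
      then show ?thesis
        by (simp add: expand_linear(2) trilinear_linear[OF triT])
    qed
    ultimately show ?thesis by simp
  qed
  then show ?thesis by (simp add: fun_eq_iff)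
qed

text \<open>For an indefinite form, mutual orthogonality alone does not make a sum direct: a class might
  contain a nonzero vector orthogonal to the whole class. But if the classes span everything, such a vector is orthogonal to
  all torsion tensors, hence zero.\<close>

lemma orthogonal_direct_sum:
  assumes fin: "finite I"
    and sub: "\<And>i. i \<in> I \<Longrightarrow> tensor.subspace (S i)" "\<And>i. i \<in> I \<Longrightarrow> S i \<subseteq> torsion_tensors"
    and orth: "\<And>i j X Y. \<lbrakk>i \<in> I; j \<in> I; i \<noteq> j; X \<in> S i; Y \<in> S j\<rbrakk> \<Longrightarrow> tensor_inner g B X Y = 0"
    and span: "torsion_tensors \<subseteq> tensor.span (\<Union>i\<in>I. S i)"
  shows "is_direct_sum torsion_tensors I S"
proof -
  define W where "W = {T. \<exists>U. (\<forall>i\<in>I. U i \<in> S i) \<and> T = (\<Sum>i\<in>I. U i)}"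
  have "tensor.subspace W"
    unfolding tensor.subspace_def
  proof (intro conjI ballI allI)
    show "0 \<in> W" unfolding W_def using sub(1)
      by (auto intro!: exI[of _ "\<lambda>_. 0"] simp: tensor.subspace_0)
    fix X Y assume "X \<in> W" "Y \<in> W"
    then obtain U U' where "\<forall>i\<in>I. U i \<in> S i" "X = (\<Sum>i\<in>I. U i)" "\<forall>i\<in>I. U' i \<in> S i" "Y = (\<Sum>i\<in>I. U' i)"
      unfolding W_def by blast
    then show "X + Y \<in> W" unfolding W_def using sub(1)
      by (auto intro!: exI[of _ "\<lambda>i. U i + U' i"] simp: tensor.subspace_add sum.distrib)
  next
    fix c X assume "X \<in> W"
    then obtain U where "\<forall>i\<in>I. U i \<in> S i" "X = (\<Sum>i\<in>I. U i)"
      unfolding W_def by blast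
    then show "tensor_scale c X \<in> W" unfolding W_def using sub(1)
      by (auto intro!: exI[of _ "\<lambda>i. tensor_scale c (U i)"]
          simp: tensor.subspace_scale tensor.scale_sum_right)
  qed
  moreover have "(\<Union>i\<in>I. S i) \<subseteq> W"
  proof
    fix X assume "X \<in> (\<Union>i\<in>I. S i)"
    then obtain i where i: "i \<in> I" "X \<in> S i" by blast
    have "X = (\<Sum>j\<in>I. if j = i then X else 0)" using fin i(1) by simp
    then show "X \<in> W" unfolding W_def using sub(1) i
      by (auto intro!: exI[of _ "\<lambda>j. if j = i then X else 0"] simp: tensor.subspace_0)
  qed
  ultimately have sum: "torsion_tensors \<subseteq> W"
    using span tensor.span_minimal by blast
  have uniq: "U i = U' i"
    if U: "\<forall>i\<in>I. U i \<in> S i" "\<forall>i\<in>I. U' i \<in> S i" "(\<Sum>i\<in>I. U i) = (\<Sum>i\<in>I. U' i)" and i: "i \<in> I"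
    for U U' i
  proof -
    define D where "D j = U j - U' j" for j
    have D: "D j \<in> S j" if "j \<in> I" for j
      unfolding D_def using U sub(1) that by (blast intro: tensor.subspace_diff)
    have D0: "(\<Sum>j\<in>I. D j) = 0" using U(3) by (simp add: D_def sum_subtractf)
    \<comment> \<open>\<open>D i\<close> pairs with a sum of class members as the zero tensor \<open>\<Sum>\<^sub>j D j\<close> pairs with the \<open>i\<close>-th one.\<close>
    have "D i = 0"
    proof (rule inner_nondegenerate)
      show "D i \<in> torsion_tensors" using D i sub(2) by blast
      fix Y :: "'v tensor3" assume "Y \<in> torsion_tensors"
      then obtain V where V: "\<forall>i\<in>I. V i \<in> S i" "Y = (\<Sum>i\<in>I. V i)"
        using sum unfolding W_def by blast
      have "tensor_inner g B (D i) Y = (\<Sum>j\<in>I. tensor_inner g B (D i) (V j))"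
        unfolding V(2) by (rule tensor_functional_sum[OF tensor_functional_inner(2)])
      also have "\<dots> = (\<Sum>j\<in>I. if j = i then tensor_inner g B (D i) (V i) else 0)"
        using D V i orth by (intro sum.cong) auto
      also have "\<dots> = (\<Sum>j\<in>I. tensor_inner g B (D j) (V i))"
        using D V i orth by (intro sum.cong) auto
      also have "\<dots> = tensor_inner g B (\<Sum>j\<in>I. D j) (V i)"
        by (rule tensor_functional_sum[OF tensor_functional_inner(1), symmetric])
      finally show "tensor_inner g B (D i) Y = 0" by (simp add: D0 inner_simps)
    qed
    then show ?thesis by (simp add: D_def)
  qed
  show ?thesis
    unfolding is_direct_sum_def
  proof (intro conjI ballI subspace_torsion_tensors)
    fix T :: "'v tensor3" assume "T \<in> torsion_tensors"
    then obtain U where U: "\<forall>i\<in>I. U i \<in> S i" "T = (\<Sum>i\<in>I. U i)"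
      using sum unfolding W_def by blast
    show "\<exists>!U. U \<in> (\<Pi>\<^sub>E i\<in>I. S i) \<and> T = (\<Sum>i\<in>I. U i)"
    proof (rule ex1I[of _ "restrict U I"])
      show "restrict U I \<in> (\<Pi>\<^sub>E i\<in>I. S i) \<and> T = (\<Sum>i\<in>I. restrict U I i)"
        using U by auto
      fix U' assume U': "U' \<in> (\<Pi>\<^sub>E i\<in>I. S i) \<and> T = (\<Sum>i\<in>I. U' i)"
      have "\<forall>i\<in>I. U' i = U i" using uniq[of U' U] U U' by (auto simp: PiE_iff)
      then show "U' = restrict U I" using U' by (auto simp: PiE_iff extensional_def fun_eq_iff)
    qed
  qed (use sub in auto)
qed

end

section \<open>Almost contact B-metric structures with a basis\<close>

locale almost_contact_basis = almost_contact_B_metric n \<phi> \<xi> \<eta> g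
  for n :: nat and \<phi> :: "'v::real_vector \<Rightarrow> 'v" and \<xi> :: 'v and \<eta> :: "'v \<Rightarrow> real"
    and g :: "'v \<Rightarrow> 'v \<Rightarrow> real" +
  fixes B :: "'v set"
  assumes independent_B: "independent B" and span_B: "span B = UNIV"
begin

lemma orthonormal_basis:
  obtains E where "finite E" "independent E" "span E = UNIV"
    "\<And>u. u \<in> E \<Longrightarrow> g u u \<noteq> 0" "\<And>u v. u \<in> E \<Longrightarrow> v \<in> E \<Longrightarrow> u \<noteq> v \<Longrightarrow> g u v = 0"
proof -
  from signature obtain P N where *: "finite P \<and> finite N \<and> P \<inter> N = {} \<and> card P = n + 1 \<and> card N = n \<and>
        independent (P \<union> N) \<and> span (P \<union> N) = UNIV \<and>
        (\<forall>u\<in>P. g u u = 1) \<and> (\<forall>u\<in>N. g u u = -1) \<and>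
        (\<forall>u\<in>P \<union> N. \<forall>v\<in>P \<union> N. u \<noteq> v \<longrightarrow> g u v = 0)"
    unfolding inner_product_of_signature_def by (elim conjE exE) (rule that, intro conjI)
  have "finite (P \<union> N)" "independent (P \<union> N)" "span (P \<union> N) = UNIV" using * by simp_all
  moreover have "g u u \<noteq> 0" if "u \<in> P \<union> N" for u
    using * that by (metis Un_iff neg_equal_0_iff_equal zero_neq_one)
  moreover have "g u v = 0" if "u \<in> P \<union> N" "v \<in> P \<union> N" "u \<noteq> v" for u v
    using * that by simp
  ultimately show thesis by (rule that)
qed

sublocale metric_basis g B
proof (rule metric_basis.intro)
  have lin: "linear (g x)" for x
    using signature unfolding inner_product_of_signature_def by (elim conjE) (rule spec)
  have sym: "g x y = g y x" for x y
    using signature unfolding inner_product_of_signature_def by (elim conjE) metis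
  show "linear (g x)" for x by (rule lin)
  show "g x y = g y x" for x y by (rule sym)
  obtain E where E: "finite E" "independent E" "span E = UNIV"
    "\<And>u. u \<in> E \<Longrightarrow> g u u \<noteq> 0" "\<And>u v. u \<in> E \<Longrightarrow> v \<in> E \<Longrightarrow> u \<noteq> v \<Longrightarrow> g u v = 0"
    by (rule orthonormal_basis[OF that])
  show "x = 0" if "\<And>y. g x y = 0" for x
  proof -
    have x: "(\<Sum>e\<in>E. representation E x e *\<^sub>R e) = x"
      by (rule real_vector.sum_representation_eq) (use E in auto)
    have "representation E x u = 0" if "u \<in> E" for u
    proof -
      have "0 = g u x" using \<open>\<And>y. g x y = 0\<close>[of u] by (simp add: sym)
      also have "\<dots> = (\<Sum>e\<in>E. representation E x e * g u e)"
        by (subst x[symmetric]) (simp add: linear_sum[OF lin] linear_scale[OF lin])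
      also have "\<dots> = (\<Sum>e\<in>E. if e = u then representation E x u * g u u else 0)"
        using E(5) that by (intro sum.cong) auto
      finally show ?thesis using E(1,4) that by simp
    qed
    then show ?thesis using x by simp
  qed
  show "finite B"
    using real_vector.independent_span_bound[OF E(1) independent_B] E(3) by simp
qed (rule independent_B span_B)+

lemma card_B: "card B = 2 * n + 1"
  using dim_V real_vector.dim_eq_card[of B UNIV] independent_B span_B by simp

lemma eta_form: "\<eta> x = g x \<xi>" "\<eta> x = g \<xi> x"
proof -
  show "\<eta> x = g x \<xi>" using g_phi_phi[of x \<xi>] by (simp add: phi_xi eta_xi)
  then show "\<eta> x = g \<xi> x" by (simp add: form_sym)
qed

lemma phi_self_adjoint: "g (\<phi> x) y = g x (\<phi> y)"
proof -
  have "g (\<phi> x) (\<phi> (\<phi> y)) = - g x (\<phi> y)" by (simp add: g_phi_phi eta_phi)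
  moreover have "g (\<phi> x) (\<phi> (\<phi> y)) = - g (\<phi> x) y"
    by (simp add: phi_phi eta_form(1)[symmetric] eta_phi)
  ultimately show ?thesis by simp
qed

lemmas phi_linear [simp] = linear_add[OF linear_phi] linear_diff[OF linear_phi]
  linear_neg[OF linear_phi] linear_scale[OF linear_phi] linear_0[OF linear_phi]
lemmas eta_linear [simp] = linear_add[OF linear_eta] linear_diff[OF linear_eta]
  linear_neg[OF linear_eta] linear_scale[OF linear_eta] linear_0[OF linear_eta]
lemmas structure_simps [simp] = phi_xi eta_phi eta_xi

definition hor :: "'v \<Rightarrow> 'v" where "hor x = x - \<eta> x *\<^sub>R \<xi>"

definition vert :: "'v \<Rightarrow> 'v" where "vert x = \<eta> x *\<^sub>R \<xi>"

lemma linear_hor: "linear hor" and linear_vert: "linear vert"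
  by (rule linearI; simp add: hor_def vert_def algebra_simps)+

lemma hor_self_adjoint: "g (hor x) y = g x (hor y)" and vert_self_adjoint: "g (vert x) y = g x (vert y)"
  by (simp_all add: hor_def vert_def eta_form(1)[symmetric] eta_form(2)[symmetric])

lemma hor_simps [simp]: "\<eta> (hor x) = 0" "hor \<xi> = 0" "\<phi> (hor x) = \<phi> x" "hor (\<phi> x) = \<phi> x"
  by (simp_all add: hor_def)

text \<open>Self-adjointness with respect to \<open>g\<close> says nothing about this trace. But \<open>\<phi>\<close> is skew for the positive
  definite form \<open>H\<close>, obtained from coordinates by averaging over \<open>\<phi>\<close>, and the trace of an endomorphism can be
  computed with any nondegenerate form.\<close>

lemma trace_phi: "trace (\<lambda>x y. g x (\<phi> y)) = 0"
proof -
  define c where "c b x = representation B x b" for b x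
  have c: "linear (c b)" for b
    unfolding c_def
    by (rule linearI) (simp_all add: real_vector.representation_add[OF independent_B]
        real_vector.representation_scale[OF independent_B] span_B)
  define H where "H x y = (\<Sum>b\<in>B. c b (\<phi> x) * c b (\<phi> y) + c b (\<phi> (\<phi> x)) * c b (\<phi> (\<phi> y))) + \<eta> x * \<eta> y"
    for x y
  have phi3: "\<phi> (\<phi> (\<phi> x)) = - \<phi> x" for x by (simp add: phi_phi)
  have skew: "H (\<phi> x) y = - H x (\<phi> y)" for x y
    unfolding H_def
    by (simp add: phi3 linear_neg[OF c] sum_negf sum_subtractf sum.distrib algebra_simps)
  interpret H: metric_basis H B
  proof (rule metric_basis.intro)
    show "linear (H x)" for x unfolding H_def
      by (intro linear_compose_add linear_compose_sum ballI linearI)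
        (simp_all add: linear_add[OF c] linear_scale[OF c] algebra_simps)
    show "H x y = H y x" for x y by (simp add: H_def mult.commute)
    show "x = 0" if "\<And>y. H x y = 0" for x
    proof -
      have nonneg: "0 \<le> c b (\<phi> x) * c b (\<phi> x) + c b (\<phi> (\<phi> x)) * c b (\<phi> (\<phi> x))" for b by simp
      have 0: "(\<Sum>b\<in>B. c b (\<phi> x) * c b (\<phi> x) + c b (\<phi> (\<phi> x)) * c b (\<phi> (\<phi> x))) + \<eta> x * \<eta> x = 0"
        using that[of x] by (simp add: H_def)
      have "0 \<le> (\<Sum>b\<in>B. c b (\<phi> x) * c b (\<phi> x) + c b (\<phi> (\<phi> x)) * c b (\<phi> (\<phi> x)))"
        by (intro sum_nonneg nonneg)
      with 0 have eta: "\<eta> x = 0"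
        and s: "(\<Sum>b\<in>B. c b (\<phi> x) * c b (\<phi> x) + c b (\<phi> (\<phi> x)) * c b (\<phi> (\<phi> x))) = 0"
        using not_square_less_zero[of "\<eta> x"] by (auto simp: add_nonneg_eq_0_iff)
      have "c b (\<phi> (\<phi> x)) = 0" if "b \<in> B" for b
        using s that finite_basis nonneg
        by (subst (asm) sum_nonneg_eq_0_iff) (auto simp: sum_squares_eq_zero_iff)
      then have "\<phi> (\<phi> x) = 0"
        using basis_expansion[of "\<phi> (\<phi> x)"] by (simp add: c_def)
      then show "x = 0" using eta by (simp add: phi_phi)
    qed
  qed (rule finite_basis independent_basis span_basis)+
  have lin: "linear (H (\<phi> x))" "linear (\<lambda>x. H (\<phi> x) y)" for x y
    by (auto intro: H.linear_form linearI)
  have "H.trace (\<lambda>x y. H (\<phi> y) x) = H.trace (\<lambda>x y. H (\<phi> x) y)"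
    by (rule H.trace_flip) (rule lin)+
  moreover have "(\<lambda>x y. H (\<phi> y) x) = (\<lambda>x y. - H (\<phi> x) y)"
    using skew H.form_sym by (intro ext) metis
  ultimately have "H.trace (\<lambda>x y. H (\<phi> x) y) = 0"
    by (simp add: H.trace_minus)
  then have "trace (\<lambda>x y. g (\<phi> x) y) = 0"
    by (simp add: H.trace_endomorphism trace_endomorphism)
  then show ?thesis by (simp add: phi_self_adjoint)
qed

lemma trace_hor: "trace (\<lambda>x y. g x (hor y)) = 2 * real n"
proof -
  have "trace (\<lambda>x y. g x (hor y)) = trace g - trace (\<lambda>x y. g \<xi> x * \<eta> y)"
    by (simp add: trace_diff[symmetric] hor_def eta_form(1)[symmetric] eta_form(2)[symmetric] mult.commute)
  then show ?thesis by (simp add: trace_form card_B trace_product linear_eta)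
qed

lemma trace_phi_phi: "trace (\<lambda>x y. g x (\<phi> (\<phi> y))) = - 2 * real n"
proof -
  have "\<phi> (\<phi> y) = - hor y" for y by (simp add: phi_phi hor_def)
  then show ?thesis using trace_hor by (simp add: trace_minus)
qed

section \<open>Orthogonality of the classes\<close>

text \<open>The main source of orthogonality: a self-adjoint operator on each argument makes a self-adjoint
  operator on tensors, and its eigenspaces for different eigenvalues are orthogonal.\<close>

lemma eigentensors_orthogonal:
  assumes tri: "trilinear S" "trilinear T"
    and lin: "linear A" "linear C" "linear D"
    and adj: "\<And>x y. g (A x) y = g x (A y)" "\<And>x y. g (C x) y = g x (C y)"
      "\<And>x y. g (D x) y = g x (D y)"
    and S: "\<And>x y z. S (A x) (C y) (D z) = a * S x y z"
    and T: "\<And>x y z. T (A x) (C y) (D z) = b * T x y z"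
    and "a \<noteq> b"
  shows "tensor_inner g B S T = 0"
proof -
  have "tensor_inner g B (\<lambda>x y z. S (A x) (C y) (D z)) T =
      tensor_inner g B S (\<lambda>x y z. T (A x) (C y) (D z))"
    by (rule inner_slots[OF tri lin adj])
  moreover have "(\<lambda>x y z. S (A x) (C y) (D z)) = tensor_scale a S"
    "(\<lambda>x y z. T (A x) (C y) (D z)) = tensor_scale b T"
    by (simp_all add: fun_eq_iff S T)
  ultimately show ?thesis using \<open>a \<noteq> b\<close> by (simp add: inner_simps)
qed

lemma orthogonal_if_phi_phi_id:
  assumes "trilinear S" "trilinear T"
    and "\<And>x y z. S (\<phi> x) (\<phi> y) z = a * S x y z" "\<And>x y z. T (\<phi> x) (\<phi> y) z = b * T x y z" "a \<noteq> b"
  shows "tensor_inner g B S T = 0"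
  by (rule eigentensors_orthogonal[of S T \<phi> \<phi> "\<lambda>x. x" a b])
    (use assms in \<open>auto simp: phi_self_adjoint linear_phi linear_ident\<close>)

lemma orthogonal_if_id_phi_phi:
  assumes "trilinear S" "trilinear T"
    and "\<And>x y z. S x (\<phi> y) (\<phi> z) = a * S x y z" "\<And>x y z. T x (\<phi> y) (\<phi> z) = b * T x y z" "a \<noteq> b"
  shows "tensor_inner g B S T = 0"
  by (rule eigentensors_orthogonal[of S T "\<lambda>x. x" \<phi> \<phi> a b])
    (use assms in \<open>auto simp: phi_self_adjoint linear_phi linear_ident\<close>)

lemma orthogonal_if_vert:
  assumes "trilinear S" "trilinear T" "\<And>x y. S x y \<xi> = 0" "\<And>x y z. T x y z = \<eta> z * T x y \<xi>"
  shows "tensor_inner g B S T = 0"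
proof (rule eigentensors_orthogonal[of S T "\<lambda>x. x" "\<lambda>x. x" vert 0 1])
  show "T x y (vert z) = 1 * T x y z" for x y z
    using assms(4)[of x y z] by (simp add: vert_def trilinear_simps[OF assms(2)])
  show "S x y (vert z) = 0 * S x y z" for x y z
    by (simp add: vert_def trilinear_simps[OF assms(1)] assms(3))
qed (simp_all add: assms(1,2) vert_self_adjoint linear_vert linear_ident)

lemma orthogonal_if_hor:
  assumes "trilinear S" "trilinear T" "\<And>y z. S \<xi> y z = 0" "\<And>x z. S x \<xi> z = 0"
    and "\<And>x y z. T (hor x) (hor y) z = 0"
  shows "tensor_inner g B S T = 0"
proof (rule eigentensors_orthogonal[of S T hor hor "\<lambda>x. x" 1 0])
  show "S (hor x) (hor y) z = 1 * S x y z" for x y z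
    by (simp add: hor_def trilinear_simps[OF assms(1)] assms(3,4))
qed (simp_all add: assms(1,2,5) hor_self_adjoint linear_hor linear_ident)

definition perpendicular :: "'v tensor3 set \<Rightarrow> 'v tensor3 set \<Rightarrow> bool" where
  "perpendicular X Y \<longleftrightarrow> (\<forall>S\<in>X. \<forall>T\<in>Y. tensor_inner g B S T = 0)"

lemma torsion_tensorsD:
  assumes "T \<in> torsion_tensors"
  shows "trilinear T" "T y x z = - T x y z" "T x x z = 0"
proof -
  show "trilinear T" "T y x z = - T x y z"
    using assms unfolding torsion_tensors_iff by blast+
  have "T x x z = - T x x z" using assms unfolding torsion_tensors_iff by blast
  then show "T x x z = 0" by simp
qed

lemma P1_D:
  assumes "T \<in> P1 \<xi>"
  shows "T \<in> torsion_tensors" "trilinear T" "T \<xi> y z = 0" "T x \<xi> z = 0" "T x y \<xi> = 0"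
    "T (hor x) y z = T x y z" "T x (hor y) z = T x y z" "T x y (hor z) = T x y z"
    "T (\<phi> (\<phi> x)) y z = - T x y z" "T x (\<phi> (\<phi> y)) z = - T x y z" "T x y (\<phi> (\<phi> z)) = - T x y z"
proof -
  show tor: "T \<in> torsion_tensors" using assms by (simp add: P1_def)
  then show tri: "trilinear T" by (rule torsion_tensorsD)
  show 1: "T \<xi> y z = 0" for y z using assms by (simp add: P1_def)
  show 2: "T x \<xi> z = 0" for x z using 1[of x z] torsion_tensorsD(2)[OF tor, of x \<xi> z] by simp
  show 3: "T x y \<xi> = 0" for x y using assms by (simp add: P1_def)
  show "T (hor x) y z = T x y z" "T x (hor y) z = T x y z" "T x y (hor z) = T x y z"
    "T (\<phi> (\<phi> x)) y z = - T x y z" "T x (\<phi> (\<phi> y)) z = - T x y z" "T x y (\<phi> (\<phi> z)) = - T x y z"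
    by (simp_all add: hor_def phi_phi trilinear_simps[OF tri] 1 2 3)
qed

lemma P2_D:
  assumes "T \<in> P2 \<phi> \<xi> \<eta>"
  shows "T \<in> torsion_tensors" "trilinear T" "T \<xi> y z = 0" "T x \<xi> z = 0" "T x y z = \<eta> z * T x y \<xi>"
proof -
  show tor: "T \<in> torsion_tensors" using assms by (simp add: P2_def)
  then show tri: "trilinear T" by (rule torsion_tensorsD)
  have eq: "T x y z = \<eta> z * T (\<phi> (\<phi> x)) (\<phi> (\<phi> y)) \<xi>" for x y z
    using assms unfolding P2_def by blast
  show "T \<xi> y z = 0" "T x \<xi> z = 0" by (subst eq, simp add: trilinear_simps[OF tri])+
  show "T x y z = \<eta> z * T x y \<xi>" using eq[of x y z] eq[of x y \<xi>] by simp
qed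

lemma P3_D:
  assumes "T \<in> P3 \<phi> \<xi> \<eta>"
  shows "T \<in> torsion_tensors" "trilinear T" "T \<xi> \<xi> z = 0" "T x y \<xi> = 0" "T (hor x) (hor y) z = 0"
    "T x y z = \<eta> x * T \<xi> y z - \<eta> y * T \<xi> x z"
proof -
  show tor: "T \<in> torsion_tensors" using assms by (simp add: P3_def)
  then show tri: "trilinear T" by (rule torsion_tensorsD)
  have eq: "T x y z = \<eta> x * T \<xi> (\<phi> (\<phi> y)) (\<phi> (\<phi> z)) - \<eta> y * T \<xi> (\<phi> (\<phi> x)) (\<phi> (\<phi> z))" for x y z
    using assms unfolding P3_def by blast
  show "T \<xi> \<xi> z = 0" by (rule torsion_tensorsD(3)[OF tor])
  show "T x y \<xi> = 0" "T (hor x) (hor y) z = 0"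
    by (subst eq, simp add: trilinear_simps[OF tri])+
  show "T x y z = \<eta> x * T \<xi> y z - \<eta> y * T \<xi> x z"
    using eq[of x y z] eq[of \<xi> y z] eq[of \<xi> x z]
    by (simp add: trilinear_simps[OF tri] algebra_simps)
qed

lemma P41_D:
  assumes "T \<in> P41 \<xi> \<eta>"
  shows "T \<in> torsion_tensors" "trilinear T" "T (hor x) (hor y) z = 0" "T x y z = \<eta> z * T x y \<xi>"
proof -
  show tor: "T \<in> torsion_tensors" using assms by (simp add: P41_def)
  then show tri: "trilinear T" by (rule torsion_tensorsD)
  have eq: "T x y z = \<eta> z * (\<eta> y * T x \<xi> \<xi> - \<eta> x * T y \<xi> \<xi>)" for x y z
    using assms unfolding P41_def torsion_t_hat_def by blast
  show "T (hor x) (hor y) z = 0" by (subst eq) simp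
  show "T x y z = \<eta> z * T x y \<xi>" using eq[of x y z] eq[of x y \<xi>] by simp
qed

lemma orthogonal_P1_P2: "perpendicular (P1 \<xi>) (P2 \<phi> \<xi> \<eta>)"
  unfolding perpendicular_def
  by (intro ballI orthogonal_if_vert) (blast intro: P1_D P2_D)+

lemma orthogonal_P1_P3: "perpendicular (P1 \<xi>) (P3 \<phi> \<xi> \<eta>)"
  unfolding perpendicular_def
  by (intro ballI orthogonal_if_hor) (blast intro: P1_D P3_D)+

lemma orthogonal_P1_P41: "perpendicular (P1 \<xi>) (P41 \<xi> \<eta>)"
  unfolding perpendicular_def
  by (intro ballI orthogonal_if_vert) (blast intro: P1_D P41_D)+

lemma orthogonal_P2_P3: "perpendicular (P2 \<phi> \<xi> \<eta>) (P3 \<phi> \<xi> \<eta>)"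
  unfolding perpendicular_def
  by (intro ballI orthogonal_if_hor) (blast intro: P2_D P3_D)+

lemma orthogonal_P2_P41: "perpendicular (P2 \<phi> \<xi> \<eta>) (P41 \<xi> \<eta>)"
  unfolding perpendicular_def
  by (intro ballI orthogonal_if_hor) (blast intro: P2_D P41_D)+

lemma orthogonal_P3_P41: "perpendicular (P3 \<phi> \<xi> \<eta>) (P41 \<xi> \<eta>)"
  unfolding perpendicular_def
  by (intro ballI orthogonal_if_vert) (blast intro: P3_D P41_D)+

lemma P11_D:
  assumes "T \<in> P11 \<phi> \<xi>"
  shows "T \<in> P1 \<xi>" "T (\<phi> x) (\<phi> y) z = - T x y z" "T x (\<phi> y) (\<phi> z) = - T x y z"
    "T (\<phi> x) y (\<phi> z) = - T x y z"
proof -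
  show P1: "T \<in> P1 \<xi>" using assms by (simp add: P11_def)
  have eq: "T x y z = - T (\<phi> x) (\<phi> y) z" "T x y z = - T x (\<phi> y) (\<phi> z)" for x y z
    using assms unfolding P11_def by blast+
  show *: "T (\<phi> x) (\<phi> y) z = - T x y z" "T x (\<phi> y) (\<phi> z) = - T x y z" for x y z
    using eq[of x y z] by simp_all
  show "T (\<phi> x) y (\<phi> z) = - T x y z"
    using *(2)[of x y z] *(1)[of x "\<phi> y" "\<phi> z"] P1_D(10)[OF P1, of "\<phi> x" y "\<phi> z"] by simp
qed

lemma P12_D:
  assumes "T \<in> P12 \<phi> \<xi>"
  shows "T \<in> P1 \<xi>" "T (\<phi> x) (\<phi> y) z = - T x y z" "T x (\<phi> y) (\<phi> z) = T x y z"
proof -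
  show P1: "T \<in> P1 \<xi>" using assms by (simp add: P12_def)
  have eq: "T x y z = - T (\<phi> x) (\<phi> y) z" "T x y z = T (\<phi> x) y (\<phi> z)" for x y z
    using assms unfolding P12_def by blast+
  show "T (\<phi> x) (\<phi> y) z = - T x y z" using eq(1)[of x y z] by simp
  show "T x (\<phi> y) (\<phi> z) = T x y z"
    using eq(1)[of x "\<phi> y" "\<phi> z"] eq(2)[of x y z] P1_D(10)[OF P1, of "\<phi> x" y "\<phi> z"] by simp
qed

lemma P13_D:
  assumes "T \<in> P13 \<phi> \<xi>"
  shows "T \<in> P1 \<xi>" "T (\<phi> x) (\<phi> y) z = T x y z" "T x y z + T y z x + T z x y = 0"
  using assms unfolding P13_def by (simp, metis (mono_tags, lifting) mem_Collect_eq, blast)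

lemma P14_D:
  assumes "T \<in> P14 \<phi> \<xi>"
  shows "T \<in> P1 \<xi>" "T (\<phi> x) (\<phi> y) z = T x y z" "T (\<phi> x) y z + T (\<phi> y) z x + T (\<phi> z) x y = 0"
  using assms unfolding P14_def by (simp, metis (mono_tags, lifting) mem_Collect_eq, blast)

text \<open>On tensors with \<open>T(\<phi>x, \<phi>y, z) = T(x, y, z)\<close>, the real form of the transposition of the two complex
  arguments of equal type. The first two summands are the transpositions of the last argument with each
  of the others; averaging over \<open>\<phi>\<close> in the first two arguments removes components of other types.\<close>

definition exchange :: "'v tensor3 \<Rightarrow> 'v tensor3" where
  "exchange T = (\<lambda>x y z. (T z y x + T x z y + T z (\<phi> y) (\<phi> x) + T (\<phi> x) z (\<phi> y)) / 2)"

lemma phi_shift: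
  assumes "T \<in> P1 \<xi>" "\<And>x y z. T (\<phi> x) (\<phi> y) z = T x y z"
  shows "T x (\<phi> y) z = - T (\<phi> x) y z"
  using assms(2)[of x "\<phi> y" z] P1_D(10)[OF assms(1), of "\<phi> x" y z] by simp

lemma exchange_P13:
  assumes "T \<in> P13 \<phi> \<xi>" shows "exchange T = T"
proof (intro ext)
  fix x y z
  note D = P13_D[OF assms]
  note anti = torsion_tensorsD(2)[OF P1_D(1)[OF D(1)]]
  show "exchange T x y z = T x y z"
    unfolding exchange_def
    using D(3)[of x y z] D(3)[of "\<phi> x" "\<phi> y" z] D(2)[of x y z]
      anti[of z y x] anti[of z x y] anti[of z "\<phi> y" "\<phi> x"] anti[of z "\<phi> x" "\<phi> y"]
    by argo
qed

lemma exchange_P14: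
  assumes "T \<in> P14 \<phi> \<xi>" shows "exchange T = - T"
proof (intro ext)
  fix x y z
  note D = P14_D[OF assms]
  note anti = torsion_tensorsD(2)[OF P1_D(1)[OF D(1)]]
  note shift = phi_shift[OF D(1,2)]
  note sq = P1_D(9,10,11)[OF D(1)]
  show "exchange T x y z = (- T) x y z"
    unfolding exchange_def
    using D(3)[of "\<phi> x" y z] D(3)[of x "\<phi> y" z] D(2)[of z x y] D(2)[of x y z]
      sq(1)[of x y z] sq(1)[of y z x] shift[of z x "\<phi> y"]
      anti[of z y x] anti[of z x y] anti[of z "\<phi> y" "\<phi> x"] anti[of z "\<phi> x" "\<phi> y"]
    unfolding uminus_apply by argo
qed

text \<open>The exchange is self-adjoint on the tensors fixed by \<open>\<phi>\<close> in the first two arguments: there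
  the last two summands may be traded for the first two.\<close>

lemma inner_exchange:
  assumes S: "S \<in> P1 \<xi>" "\<And>x y z. S (\<phi> x) (\<phi> y) z = S x y z"
    and T: "T \<in> P1 \<xi>" "\<And>x y z. T (\<phi> x) (\<phi> y) z = T x y z"
  shows "tensor_inner g B (exchange S) T = tensor_inner g B S (exchange T)"
proof -
  have main: "tensor_inner g B (exchange S) T = 2 * tensor_inner g B (\<lambda>x y z. S z y x) T"
    if S: "S \<in> P1 \<xi>" "\<And>x y z. S (\<phi> x) (\<phi> y) z = S x y z"
      and T: "T \<in> P1 \<xi>" "\<And>x y z. T (\<phi> x) (\<phi> y) z = T x y z" for S T
  proof -
    note triS = P1_D(2)[OF S(1)] and triT = P1_D(2)[OF T(1)]
    let ?R = "\<lambda>x y z. S z y x" and ?R' = "\<lambda>x y z. S x z y"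
    have triR: "trilinear ?R" "trilinear ?R'" using triS by (auto simp: trilinear_def)
    have ex: "exchange S = tensor_scale (1/2) (?R + ?R' + (\<lambda>x y z. ?R (\<phi> x) (\<phi> y) z)
        + (\<lambda>x y z. ?R' (\<phi> x) (\<phi> y) z))"
      by (simp add: exchange_def fun_eq_iff)
    have phi: "tensor_inner g B (\<lambda>x y z. R (\<phi> x) (\<phi> y) z) T = tensor_inner g B R T"
      if "trilinear R" for R
      using inner_slots[OF that triT linear_phi linear_phi linear_ident, of \<phi> \<phi> "\<lambda>x. x"]
      by (simp add: phi_self_adjoint T(2))
    have 1: "(\<lambda>x y z. ?R' y x z) = - ?R"
      by (intro ext) (subst torsion_antisym[OF P1_D(1)[OF S(1)]], simp)
    have 2: "(\<lambda>x y z. T y x z) = - T"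
      by (intro ext) (subst torsion_antisym[OF P1_D(1)[OF T(1)]], simp)
    have "tensor_inner g B ?R' T = tensor_inner g B ?R T"
      using inner_swap(1)[OF triT, of ?R'] by (simp only: 1 2 inner_simps minus_minus)
    then show ?thesis unfolding ex by (simp only: inner_simps phi[OF triR(1)] phi[OF triR(2)]) simp
  qed
  have "tensor_inner g B (\<lambda>x y z. S z y x) T = tensor_inner g B S (\<lambda>x y z. T z y x)"
    using inner_swap(3)[of "\<lambda>x y z. T z y x" S] P1_D(2)[OF T(1)] by (simp add: trilinear_def)
  also have "\<dots> = tensor_inner g B (\<lambda>x y z. T z y x) S"
    using P1_D(2)[OF T(1)] P1_D(2)[OF S(1)] by (intro inner_commute) (auto simp: trilinear_def)
  finally have "tensor_inner g B (exchange S) T = tensor_inner g B (exchange T) S"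
    by (simp add: main[OF S T] main[OF T S])
  also have "\<dots> = tensor_inner g B S (exchange T)"
  proof (rule inner_commute)
    show "trilinear (exchange T)" unfolding exchange_def
      by (rule trilinearI)
        (simp_all add: trilinear_simps[OF P1_D(2)[OF T(1)]] algebra_simps add_divide_distrib)
  qed (rule P1_D(2)[OF S(1)])
  finally show ?thesis .
qed

lemma orthogonal_P11_P12: "perpendicular (P11 \<phi> \<xi>) (P12 \<phi> \<xi>)"
  unfolding perpendicular_def
  by (intro ballI orthogonal_if_id_phi_phi[of _ _ "-1" 1])
    (simp_all add: P11_D P12_D P1_D(2)[OF P11_D(1)] P1_D(2)[OF P12_D(1)])

lemma orthogonal_P1x:
  assumes "S \<in> P11 \<phi> \<xi> \<union> P12 \<phi> \<xi>" "T \<in> P13 \<phi> \<xi> \<union> P14 \<phi> \<xi>"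
  shows "tensor_inner g B S T = 0"
  by (rule orthogonal_if_phi_phi_id[of _ _ "-1" 1])
    (use assms in \<open>auto simp: P11_D(2) P12_D(2) P13_D(2) P14_D(2) P1_D(2)[OF P11_D(1)]
      P1_D(2)[OF P12_D(1)] P1_D(2)[OF P13_D(1)] P1_D(2)[OF P14_D(1)]\<close>)

lemma orthogonal_P13_P14: "perpendicular (P13 \<phi> \<xi>) (P14 \<phi> \<xi>)"
  unfolding perpendicular_def
proof (intro ballI)
  fix S T assume S: "S \<in> P13 \<phi> \<xi>" and T: "T \<in> P14 \<phi> \<xi>"
  show "tensor_inner g B S T = 0"
    using inner_exchange[OF P13_D(1,2)[OF S] P14_D(1,2)[OF T]]
    by (simp add: exchange_P13[OF S] exchange_P14[OF T] inner_simps)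
qed

lemma orthogonal_P21_P22: "perpendicular (P21 \<phi> \<xi> \<eta>) (P22 \<phi> \<xi> \<eta>)"
  unfolding perpendicular_def
proof (intro ballI)
  fix S T assume "S \<in> P21 \<phi> \<xi> \<eta>" "T \<in> P22 \<phi> \<xi> \<eta>"
  then have S: "S \<in> P2 \<phi> \<xi> \<eta>" "\<And>x y. S x y \<xi> = - S (\<phi> x) (\<phi> y) \<xi>"
    and T: "T \<in> P2 \<phi> \<xi> \<eta>" "\<And>x y. T x y \<xi> = T (\<phi> x) (\<phi> y) \<xi>"
    unfolding P21_def P22_def by blast+
  have 1: "S (\<phi> x) (\<phi> y) z = - S x y z" for x y z
    using P2_D(5)[OF S(1), of x y z] P2_D(5)[OF S(1), of "\<phi> x" "\<phi> y" z] S(2)[of x y] by simp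
  have 2: "T (\<phi> x) (\<phi> y) z = T x y z" for x y z
    using P2_D(5)[OF T(1), of x y z] P2_D(5)[OF T(1), of "\<phi> x" "\<phi> y" z] T(2)[of x y] by simp
  show "tensor_inner g B S T = 0"
    by (rule orthogonal_if_phi_phi_id[of S T "-1" 1]) (simp_all add: 1 2 P2_D(2)[OF S(1)] P2_D(2)[OF T(1)])
qed

text \<open>A tensor of \<open>P3\<close> is the antisymmetrization of \<open>\<eta>(x) T(\<xi>, y, z)\<close>, so on \<open>P3\<close> the inner product is, up to
  a factor, that of the bilinear forms \<open>T(\<xi>, y, z)\<close>.\<close>

lemma inner_P3:
  assumes S: "S \<in> P3 \<phi> \<xi> \<eta>" and T: "T \<in> P3 \<phi> \<xi> \<eta>"
  shows "tensor_inner g B S T = 2 * tensor_inner g B (\<lambda>x y z. S (vert x) y z) (\<lambda>x y z. T (vert x) y z)"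
proof -
  note S' = P3_D[OF S] and T' = P3_D[OF T]
  let ?T = "\<lambda>x y z. T (vert x) y z"
  have tri: "trilinear ?T"
    using trilinear_slots[OF T'(2) linear_vert linear_ident linear_ident] .
  have "T = (\<lambda>x y z. ?T x y z - ?T y x z)"
    by (intro ext) (subst T'(6), simp add: vert_def trilinear_simps[OF T'(2)])
  then have "tensor_inner g B S T = 2 * tensor_inner g B S ?T"
    using inner_antisym[OF S'(1) tri] by simp
  also have "tensor_inner g B S ?T = tensor_inner g B S (\<lambda>x y z. ?T (vert x) y z)"
    by (simp add: vert_def)
  also have "\<dots> = tensor_inner g B (\<lambda>x y z. S (vert x) y z) ?T"
    by (rule inner_slots[OF S'(2) tri linear_vert linear_ident linear_ident, symmetric])
      (simp_all add: vert_self_adjoint)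
  finally show ?thesis .
qed

lemma orthogonal_P3_phi:
  assumes S: "S \<in> P3 \<phi> \<xi> \<eta>" "\<And>y z. S \<xi> y z = - S \<xi> (\<phi> y) (\<phi> z)"
    and T: "T \<in> P3 \<phi> \<xi> \<eta>" "\<And>y z. T \<xi> y z = T \<xi> (\<phi> y) (\<phi> z)"
  shows "tensor_inner g B S T = 0"
proof -
  note S' = P3_D[OF S(1)] and T' = P3_D[OF T(1)]
  have "S \<xi> (\<phi> y) (\<phi> z) = - S \<xi> y z" "T \<xi> (\<phi> y) (\<phi> z) = T \<xi> y z" for y z
    using S(2)[of y z] T(2)[of y z] by simp_all
  then have "tensor_inner g B (\<lambda>x y z. S (vert x) y z) (\<lambda>x y z. T (vert x) y z) = 0"
    by (intro orthogonal_if_id_phi_phi[of _ _ "-1" 1]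
        trilinear_slots[OF S'(2) linear_vert linear_ident linear_ident]
        trilinear_slots[OF T'(2) linear_vert linear_ident linear_ident])
      (simp_all add: vert_def trilinear_simps[OF S'(2)] trilinear_simps[OF T'(2)])
  then show ?thesis by (simp add: inner_P3[OF S(1) T(1)])
qed

lemma orthogonal_P3_sym:
  assumes S: "S \<in> P3 \<phi> \<xi> \<eta>" "\<And>y z. S \<xi> y z = S \<xi> z y"
    and T: "T \<in> P3 \<phi> \<xi> \<eta>" "\<And>y z. T \<xi> y z = - T \<xi> z y"
  shows "tensor_inner g B S T = 0"
proof -
  note S' = P3_D[OF S(1)] and T' = P3_D[OF T(1)]
  let ?S = "\<lambda>x y z. S (vert x) y z" and ?T = "\<lambda>x y z. T (vert x) y z"
  have tri: "trilinear ?T"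
    using trilinear_slots[OF T'(2) linear_vert linear_ident linear_ident] .
  have flip: "S (vert x) z y = S (vert x) y z" "T (vert x) z y = - T (vert x) y z" for x y z
    using S(2)[of z y] T(2)[of z y]
    by (simp_all add: vert_def trilinear_simps[OF S'(2)] trilinear_simps[OF T'(2)])
  have "(\<lambda>x y z. ?S x z y) = ?S" by (intro ext flip(1))
  moreover have "(\<lambda>x y z. ?T x z y) = - ?T"
    by (intro ext) (unfold uminus_apply, rule flip(2))
  ultimately have "tensor_inner g B ?S ?T = 0"
    using inner_swap(2)[OF tri, of ?S] by (simp add: inner_simps)
  then show ?thesis by (simp add: inner_P3[OF S(1) T(1)])
qed

lemma orthogonal_P3x:
  "perpendicular (P31 \<phi> \<xi> \<eta>) (P32 \<phi> \<xi> \<eta>)" "perpendicular (P31 \<phi> \<xi> \<eta>) (P33 \<phi> \<xi> \<eta>)"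
  "perpendicular (P31 \<phi> \<xi> \<eta>) (P34 \<phi> \<xi> \<eta>)" "perpendicular (P32 \<phi> \<xi> \<eta>) (P33 \<phi> \<xi> \<eta>)"
  "perpendicular (P32 \<phi> \<xi> \<eta>) (P34 \<phi> \<xi> \<eta>)" "perpendicular (P33 \<phi> \<xi> \<eta>) (P34 \<phi> \<xi> \<eta>)"
  unfolding perpendicular_def P31_def P32_def P33_def P34_def
  by (blast intro: orthogonal_P3_sym orthogonal_P3_phi)+


section \<open>Decomposition of a torsion tensor\<close>

lemma subspace_P1: "tensor.subspace (P1 \<xi>)"
  unfolding P1_def by (intro subspace_conditions tensor_functional_intros subspace_torsion_tensors)

lemma subspace_P2: "tensor.subspace (P2 \<phi> \<xi> \<eta>)"
  unfolding P2_def by (intro subspace_conditions tensor_functional_intros subspace_torsion_tensors)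

lemma subspace_P3: "tensor.subspace (P3 \<phi> \<xi> \<eta>)"
  unfolding P3_def by (intro subspace_conditions tensor_functional_intros subspace_torsion_tensors)

lemma subspace_P41: "tensor.subspace (P41 \<xi> \<eta>)"
  unfolding P41_def torsion_t_hat_def
  by (intro subspace_conditions tensor_functional_intros subspace_torsion_tensors)

lemma subspace_P1x:
  "tensor.subspace (P11 \<phi> \<xi>)" "tensor.subspace (P12 \<phi> \<xi>)" "tensor.subspace (P13 \<phi> \<xi>)"
  "tensor.subspace (P14 \<phi> \<xi>)"
  unfolding P11_def P12_def P13_def P14_def
  by (intro subspace_conditions tensor_functional_intros subspace_P1)+

lemma subspace_P2x: "tensor.subspace (P21 \<phi> \<xi> \<eta>)" "tensor.subspace (P22 \<phi> \<xi> \<eta>)"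
  unfolding P21_def P22_def
  by (intro subspace_conditions tensor_functional_intros subspace_P2)+

lemma subspace_P3x:
  "tensor.subspace (P31 \<phi> \<xi> \<eta>)" "tensor.subspace (P32 \<phi> \<xi> \<eta>)" "tensor.subspace (P33 \<phi> \<xi> \<eta>)"
  "tensor.subspace (P34 \<phi> \<xi> \<eta>)"
  unfolding P31_def P32_def P33_def P34_def
  by (intro subspace_conditions tensor_functional_intros subspace_P3)+

lemma subspace_trace_parts:
  "tensor.subspace (P112 \<phi> \<xi> g B)" "tensor.subspace (P132 \<phi> \<xi> g B)"
  "tensor.subspace (P313 \<phi> \<xi> \<eta> g B)" "tensor.subspace (P111 \<phi> \<xi> g B)"
  "tensor.subspace (P131 \<phi> \<xi> g B)" "tensor.subspace (P311 \<phi> \<xi> \<eta> g B)"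
  "tensor.subspace (P312 \<phi> \<xi> \<eta> g B)"
  unfolding P112_def P132_def P313_def P111_def P131_def P311_def P312_def
  by (intro subspace_conditions subspace_orthogonal_complement tensor_functional_torsion_t
      tensor_functional_intros subspace_P1x subspace_P3x)+

lemma torsion_tensors_slots:
  assumes "T \<in> torsion_tensors" "linear A" "linear C"
  shows "(\<lambda>x y z. T (A x) (A y) (C z)) \<in> torsion_tensors"
  unfolding torsion_tensors_iff
  using trilinear_slots[OF torsion_tensorsD(1)[OF assms(1)] assms(2,2,3)]
    torsion_tensorsD(2)[OF assms(1)] by blast

text \<open>Split each argument into its part in \<open>ker \<eta>\<close> and its part along \<open>\<xi>\<close>. By antisymmetry only four types
  of components survive, according to how often and where \<open>\<xi>\<close> occurs.\<close>

lemma torsion_decomposition: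
  assumes T: "T \<in> torsion_tensors"
  obtains T1 T2 T3 T4 where "T1 \<in> P1 \<xi>" "T2 \<in> P2 \<phi> \<xi> \<eta>" "T3 \<in> P3 \<phi> \<xi> \<eta>" "T4 \<in> P41 \<xi> \<eta>"
    "T = T1 + T2 + T3 + T4"
proof
  note tri = torsion_tensorsD(1)[OF T] and anti = torsion_tensorsD(2)[OF T]
  have xixi: "T \<xi> \<xi> z = 0" for z by (rule torsion_tensorsD(3)[OF T])
  note hor = linear_add[OF linear_hor] linear_scale[OF linear_hor]
  let ?T1 = "\<lambda>x y z. T (hor x) (hor y) (hor z)"
  let ?T2 = "\<lambda>x y z. \<eta> z * T (hor x) (hor y) \<xi>"
  let ?T3 = "\<lambda>x y z. \<eta> x * T \<xi> (hor y) (hor z) - \<eta> y * T \<xi> (hor x) (hor z)"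
  let ?T4 = "\<lambda>x y z. \<eta> z * (\<eta> y * T x \<xi> \<xi> - \<eta> x * T y \<xi> \<xi>)"
  have hor_phi: "- hor x = \<phi> (\<phi> x)" for x by (simp add: phi_phi hor_def)
  show "?T1 \<in> P1 \<xi>"
    using torsion_tensors_slots[OF T linear_hor linear_hor]
    by (simp add: P1_def trilinear_simps[OF tri])
  have "?T2 \<in> torsion_tensors"
    unfolding torsion_tensors_iff
  proof (intro conjI allI)
    show "trilinear ?T2" by (rule trilinearI) (simp_all add: trilinear_simps[OF tri] hor algebra_simps)
    show "?T2 x y z = - ?T2 y x z" for x y z using anti[of "hor x" "hor y" \<xi>] by simp
  qed
  then show "?T2 \<in> P2 \<phi> \<xi> \<eta>"
    by (simp add: P2_def hor_phi[symmetric] trilinear_simps[OF tri] linear_neg[OF linear_hor])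
      (simp add: hor_def)
  have "?T3 \<in> torsion_tensors"
    unfolding torsion_tensors_iff
  proof (intro conjI allI)
    show "trilinear ?T3" by (rule trilinearI) (simp_all add: trilinear_simps[OF tri] hor algebra_simps)
  qed simp
  then show "?T3 \<in> P3 \<phi> \<xi> \<eta>"
    by (simp add: P3_def hor_phi[symmetric] trilinear_simps[OF tri] linear_neg[OF linear_hor])
      (simp add: hor_def)
  have "?T4 \<in> torsion_tensors"
    unfolding torsion_tensors_iff
  proof (intro conjI allI)
    show "trilinear ?T4" by (rule trilinearI) (simp_all add: trilinear_simps[OF tri] algebra_simps)
  qed (simp add: algebra_simps)
  then show "?T4 \<in> P41 \<xi> \<eta>"
    by (simp add: P41_def torsion_t_hat_def xixi)
  show "T = ?T1 + ?T2 + ?T3 + ?T4"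
  proof (intro ext)
    fix x y z
    show "T x y z = (?T1 + ?T2 + ?T3 + ?T4) x y z"
      using anti[of x \<xi> z] anti[of y \<xi> z] anti[of x \<xi> \<xi>] anti[of y \<xi> \<xi>]
      by (simp add: hor_def trilinear_simps[OF tri] xixi algebra_simps)
  qed
qed

lemma P2_decomposition:
  assumes T: "T \<in> P2 \<phi> \<xi> \<eta>"
  obtains T1 T2 where "T1 \<in> P21 \<phi> \<xi> \<eta>" "T2 \<in> P22 \<phi> \<xi> \<eta>" "T = T1 + T2"
proof
  note D = P2_D[OF T] and simps = trilinear_simps[OF P2_D(2)[OF T]]
  have sq: "T (\<phi> (\<phi> x)) y z = - T x y z" "T x (\<phi> (\<phi> y)) z = - T x y z" for x y z
    by (simp_all add: phi_phi simps D(3,4))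
  let ?L = "\<lambda>x y z. T (\<phi> x) (\<phi> y) z"
  let ?T1 = "tensor_scale (1/2) (T - ?L)" and ?T2 = "tensor_scale (1/2) (T + ?L)"
  have "?L \<in> torsion_tensors" by (rule torsion_tensors_slots[OF D(1) linear_phi linear_ident])
  then have "?L \<in> P2 \<phi> \<xi> \<eta>"
    unfolding P2_def mem_Collect_eq
  proof (intro conjI allI)
    fix x y z
    show "?L x y z = \<eta> z * ?L (\<phi> (\<phi> x)) (\<phi> (\<phi> y)) \<xi>"
      using D(5)[of "\<phi> x" "\<phi> y" z] by (simp add: sq)
  qed
  then have "?T1 \<in> P2 \<phi> \<xi> \<eta>" "?T2 \<in> P2 \<phi> \<xi> \<eta>"
    using subspace_P2 T by (simp_all add: tensor.subspace_add tensor.subspace_diff tensor.subspace_scale)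
  then show "?T1 \<in> P21 \<phi> \<xi> \<eta>" "?T2 \<in> P22 \<phi> \<xi> \<eta>"
    by (simp_all add: P21_def P22_def sq field_simps)
  show "T = ?T1 + ?T2" by (simp add: fun_eq_iff field_simps)
qed

text \<open>The tensors of \<open>P3\<close> are those of this form for a bilinear form \<open>b\<close> annihilated by \<open>\<xi>\<close> on both sides
  (\<open>eta_wedge_P3\<close>); the subclasses of \<open>P3\<close> are types of bilinear forms.\<close>

definition eta_wedge :: "('v \<Rightarrow> 'v \<Rightarrow> real) \<Rightarrow> 'v tensor3" where
  "eta_wedge b = (\<lambda>x y z. \<eta> x * b y z - \<eta> y * b x z)"

lemma eta_wedge_P3:
  assumes "\<And>x. linear (b x)" "\<And>y. linear (\<lambda>x. b x y)" "\<And>x. b x \<xi> = 0" "\<And>y. b \<xi> y = 0"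
  shows "eta_wedge b \<in> P3 \<phi> \<xi> \<eta>"
proof -
  note simps = linear_add[OF assms(1)] linear_add[OF assms(2)] linear_scale[OF assms(1)]
    linear_scale[OF assms(2)] linear_diff[OF assms(1)] linear_diff[OF assms(2)]
  have sq: "b (\<phi> (\<phi> x)) y = - b x y" "b x (\<phi> (\<phi> y)) = - b x y" for x y
    by (simp_all add: phi_phi simps assms(3,4))
  have "eta_wedge b \<in> torsion_tensors"
    unfolding torsion_tensors_iff eta_wedge_def
    by (intro conjI allI trilinearI) (simp_all add: simps algebra_simps)
  then show ?thesis
    by (simp add: P3_def eta_wedge_def assms(3,4) sq)
qed

lemma eta_wedge_xi: "(\<And>y. b \<xi> y = 0) \<Longrightarrow> eta_wedge b \<xi> y z = b y z"
  by (simp add: eta_wedge_def)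

text \<open>The transposition of \<open>b\<close> and its pullback under \<open>\<phi>\<close> are commuting involutions, with four joint
  eigenspaces; \<open>b s p\<close> is the projection for the signs \<open>s\<close> and \<open>p\<close>.\<close>

lemma P3_decomposition:
  assumes T: "T \<in> P3 \<phi> \<xi> \<eta>"
  obtains T1 T2 T3 T4 where "T1 \<in> P31 \<phi> \<xi> \<eta>" "T2 \<in> P32 \<phi> \<xi> \<eta>" "T3 \<in> P33 \<phi> \<xi> \<eta>"
    "T4 \<in> P34 \<phi> \<xi> \<eta>" "T = T1 + T2 + T3 + T4"
proof
  note D = P3_D[OF T] and simps = trilinear_simps[OF P3_D(2)[OF T]]
  have sq: "T \<xi> (\<phi> (\<phi> y)) z = - T \<xi> y z" "T \<xi> y (\<phi> (\<phi> z)) = - T \<xi> y z" for y z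
    by (simp_all add: phi_phi simps D(3,4))
  define b where "b s p y z =
      (T \<xi> y z + s * T \<xi> z y + p * (T \<xi> (\<phi> y) (\<phi> z) + s * T \<xi> (\<phi> z) (\<phi> y))) / 4" for s p y z
  have zero: "b s p y \<xi> = 0" "b s p \<xi> y = 0" for s p y
    by (simp_all add: b_def D(3,4) simps)
  have P3: "eta_wedge (b s p) \<in> P3 \<phi> \<xi> \<eta>" for s p
  proof (rule eta_wedge_P3)
    show "linear (b s p x)" for x
      by (rule linearI) (simp_all add: b_def simps algebra_simps add_divide_distrib)
    show "linear (\<lambda>x. b s p x y)" for y
      by (rule linearI) (simp_all add: b_def simps algebra_simps add_divide_distrib)
  qed (rule zero)+
  note xi = eta_wedge_xi[of "b _ _", OF zero(2)]
  show "eta_wedge (b 1 (-1)) \<in> P31 \<phi> \<xi> \<eta>" "eta_wedge (b (-1) (-1)) \<in> P32 \<phi> \<xi> \<eta>"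
    "eta_wedge (b 1 1) \<in> P33 \<phi> \<xi> \<eta>" "eta_wedge (b (-1) 1) \<in> P34 \<phi> \<xi> \<eta>"
    unfolding P31_def P32_def P33_def P34_def mem_Collect_eq xi
    by (intro conjI allI P3; simp add: b_def sq field_simps)+
  show "T = eta_wedge (b 1 (-1)) + eta_wedge (b (-1) (-1)) + eta_wedge (b 1 1) + eta_wedge (b (-1) 1)"
  proof (intro ext)
    fix x y z
    show "T x y z = (eta_wedge (b 1 (-1)) + eta_wedge (b (-1) (-1)) + eta_wedge (b 1 1) + eta_wedge (b (-1) 1)) x y z"
      unfolding D(6)[of x y z] by (simp add: eta_wedge_def b_def field_simps)
  qed
qed

lemma exchange_P1:
  assumes T: "T \<in> P1 \<xi>" "\<And>x y z. T (\<phi> x) (\<phi> y) z = T x y z"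
  shows "exchange T \<in> P1 \<xi>" "exchange T (\<phi> x) (\<phi> y) z = exchange T x y z"
proof -
  note D = P1_D[OF T(1)]
  note anti = torsion_tensorsD(2)[OF D(1)]
  have "trilinear (exchange T)" unfolding exchange_def
    by (rule trilinearI)
      (simp_all add: trilinear_simps[OF D(2)] algebra_simps add_divide_distrib)
  moreover have "exchange T x y z = - exchange T y x z" for x y z
    unfolding exchange_def
    using anti[of z y x] anti[of x z y] anti[of z "\<phi> y" "\<phi> x"] anti[of "\<phi> x" z "\<phi> y"]
    by argo
  ultimately have "exchange T \<in> torsion_tensors"
    unfolding torsion_tensors_iff by blast
  then show "exchange T \<in> P1 \<xi>"
    by (simp add: P1_def exchange_def D trilinear_simps[OF D(2)])
  show "exchange T (\<phi> x) (\<phi> y) z = exchange T x y z"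
    by (simp add: exchange_def D(9,10,11))
qed

text \<open>The exchange negates cyclic sums and preserves those twisted by \<open>\<phi>\<close>. Hence its fixed tensors satisfy the
  condition of \<open>P13\<close>, and the tensors that it negates satisfy that of \<open>P14\<close>.\<close>

lemma exchange_cyclic:
  assumes T: "T \<in> P1 \<xi>" "\<And>x y z. T (\<phi> x) (\<phi> y) z = T x y z"
  shows "exchange T x y z + exchange T y z x + exchange T z x y = - (T x y z + T y z x + T z x y)"
    "exchange T (\<phi> x) y z + exchange T (\<phi> y) z x + exchange T (\<phi> z) x y =
      T (\<phi> x) y z + T (\<phi> y) z x + T (\<phi> z) x y"
proof -
  note D = P1_D[OF T(1)] and shift = phi_shift[OF T]
  note anti = torsion_tensorsD(2)[OF D(1)]
  have 1: "exchange T x y z = (T z (\<phi> y) (\<phi> x) - T x (\<phi> z) (\<phi> y) - T y z x - T z x y) / 2" for x y z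
    unfolding exchange_def
    using anti[of z y x] anti[of x z y] shift[of x z "\<phi> y"] by argo
  show "exchange T x y z + exchange T y z x + exchange T z x y = - (T x y z + T y z x + T z x y)"
    unfolding 1 by argo
  have 2: "exchange T (\<phi> x) y z = (T z y (\<phi> x) - T x z (\<phi> y) + T (\<phi> z) x y + T (\<phi> y) z x) / 2"
    for x y z
    unfolding exchange_def D(9,10,11)
    using anti[of z "\<phi> x" y] shift[of z x y] shift[of z y x] anti[of y "\<phi> z" x] shift[of y z x]
      anti[of "\<phi> x" z y] anti[of "\<phi> z" y x] by argo
  show "exchange T (\<phi> x) y z + exchange T (\<phi> y) z x + exchange T (\<phi> z) x y =
      T (\<phi> x) y z + T (\<phi> y) z x + T (\<phi> z) x y"
    unfolding 2 by argo
qed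

text \<open>Symmetrizing under \<open>\<phi>\<close> in the first two arguments separates \<open>P13 + P14\<close> from \<open>P11 + P12\<close>. The first pair
  is then split by the exchange and the second one by \<open>\<phi>\<close> acting on two arguments one of which is the last.\<close>

lemma P1_decomposition:
  assumes T: "T \<in> P1 \<xi>"
  obtains T1 T2 T3 T4 where "T1 \<in> P11 \<phi> \<xi>" "T2 \<in> P12 \<phi> \<xi>" "T3 \<in> P13 \<phi> \<xi>" "T4 \<in> P14 \<phi> \<xi>"
    "T = T1 + T2 + T3 + T4"
proof
  note D = P1_D[OF T]
  note anti = torsion_tensorsD(2)[OF D(1)]
  let ?L = "\<lambda>x y z. T (\<phi> x) (\<phi> y) z"
  define M where "M = (\<lambda>x y z. T x (\<phi> y) (\<phi> z) + T (\<phi> x) y (\<phi> z))"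
  have "?L \<in> torsion_tensors" by (rule torsion_tensors_slots[OF D(1) linear_phi linear_ident])
  then have L: "?L \<in> P1 \<xi>" by (simp add: P1_def D trilinear_simps[OF D(2)])
  have "M \<in> torsion_tensors"
    unfolding torsion_tensors_iff
  proof (intro conjI allI)
    show "trilinear M" unfolding M_def
      by (rule trilinearI) (simp_all add: trilinear_simps[OF D(2)] algebra_simps)
    show "M x y z = - M y x z" for x y z
      unfolding M_def using anti[of x "\<phi> y" "\<phi> z"] anti[of "\<phi> x" y "\<phi> z"] by argo
  qed
  then have M: "M \<in> P1 \<xi>" by (simp add: P1_def M_def D trilinear_simps[OF D(2)])
  note subs = tensor.subspace_add[OF subspace_P1] tensor.subspace_diff[OF subspace_P1]
    tensor.subspace_scale[OF subspace_P1]
  let ?T1 = "tensor_scale (1/4) (T - ?L - M)" and ?T2 = "tensor_scale (1/4) (T - ?L + M)"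
  have "?T1 \<in> P1 \<xi>" "?T2 \<in> P1 \<xi>" by (intro subs T L M)+
  then show "?T1 \<in> P11 \<phi> \<xi>" "?T2 \<in> P12 \<phi> \<xi>"
    by (simp_all add: P11_def P12_def M_def D(9,10,11) field_simps)
  define U where "U = tensor_scale (1/2) (T + ?L)"
  have U: "U \<in> P1 \<xi>" unfolding U_def by (intro subs T L)
  have UL: "U (\<phi> x) (\<phi> y) z = U x y z" for x y z by (simp add: U_def D(9,10,11))
  note E = exchange_P1[OF U UL] exchange_cyclic[OF U UL]
  let ?T3 = "tensor_scale (1/2) (U + exchange U)" and ?T4 = "tensor_scale (1/2) (U - exchange U)"
  have P1: "?T3 \<in> P1 \<xi>" "?T4 \<in> P1 \<xi>" by (intro subs U E(1))+
  show "?T3 \<in> P13 \<phi> \<xi>"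
    unfolding P13_def mem_Collect_eq
  proof (intro conjI allI P1)
    fix x y z
    show "?T3 x y z = ?T3 (\<phi> x) (\<phi> y) z" by (simp add: UL E(2))
    show "?T3 x y z + ?T3 y z x + ?T3 z x y = 0"
      using E(3)[of x y z] by (simp add: field_simps)
  qed
  show "?T4 \<in> P14 \<phi> \<xi>"
    unfolding P14_def mem_Collect_eq
  proof (intro conjI allI P1)
    fix x y z
    show "?T4 x y z = ?T4 (\<phi> x) (\<phi> y) z" by (simp add: UL E(2))
    show "?T4 (\<phi> x) y z + ?T4 (\<phi> y) z x + ?T4 (\<phi> z) x y = 0"
      using E(4)[of x y z] by (simp add: field_simps)
  qed
  show "T = ?T1 + ?T2 + ?T3 + ?T4"
    by (simp add: fun_eq_iff U_def field_simps)
qed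


section \<open>Trace parts\<close>

lemma torsion_t_star_trace: "trilinear T \<Longrightarrow> torsion_t_star \<phi> g B T x = trace (\<lambda>y z. T x y (\<phi> z))"
  unfolding torsion_t_star_def trace_def dual_def
  by (intro sum.cong refl)
    (simp add: linear_sum[OF linear_phi] linear_sum[OF trilinear_linear(4)] trilinear_simps)

text \<open>The wedge product of the covector \<open>g(u, \<cdot>)\<close> with the form \<open>g(\<cdot>, C \<cdot>)\<close>. The trace parts of the classes
  consist of combinations of such tensors, with \<open>C\<close> the projection to \<open>ker \<eta>\<close> or \<open>\<phi>\<close>.\<close>

definition covector_wedge :: "'v \<Rightarrow> ('v \<Rightarrow> 'v) \<Rightarrow> 'v tensor3" where
  "covector_wedge u C = (\<lambda>x y z. g u x * g y (C z) - g u y * g x (C z))"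

lemma covector_wedge_torsion:
  assumes "linear C" shows "covector_wedge u C \<in> torsion_tensors"
  unfolding torsion_tensors_iff covector_wedge_def
  by (intro conjI allI trilinearI)
    (simp_all add: linear_add[OF assms] linear_scale[OF assms] algebra_simps)

lemma covector_wedge_t:
  assumes C: "linear C"
  shows "torsion_t g B (covector_wedge u C) x = g u x * trace (\<lambda>y z. g y (C z)) - g x (C u)"
    "torsion_t_star \<phi> g B (covector_wedge u C) x = g u x * trace (\<lambda>y z. g y (C (\<phi> z))) - g x (C (\<phi> u))"
proof -
  note tri = torsion_tensorsD(1)[OF covector_wedge_torsion[OF C]]
  have "linear (\<lambda>z. g x (C z))" "linear (\<lambda>z. g x (C (\<phi> z)))"
    by (rule linearI; simp add: linear_add[OF C] linear_scale[OF C])+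
  then show "torsion_t g B (covector_wedge u C) x = g u x * trace (\<lambda>y z. g y (C z)) - g x (C u)"
    "torsion_t_star \<phi> g B (covector_wedge u C) x = g u x * trace (\<lambda>y z. g y (C (\<phi> z))) - g x (C (\<phi> u))"
    unfolding torsion_t_trace[OF tri] torsion_t_star_trace[OF tri]
    by (simp_all add: covector_wedge_def trace_diff trace_scale trace_product)
qed

lemma inner_covector_wedge:
  assumes S: "S \<in> torsion_tensors" and C: "linear C" and adj: "\<And>x y. g (C x) y = g x (C y)"
  shows "tensor_inner g B S (covector_wedge u C) = 2 * trace (\<lambda>y z. S u y (C z))"
proof -
  have "trilinear (\<lambda>x y z. g u x * g y (C z))"
    by (rule trilinearI) (simp_all add: linear_add[OF C] linear_scale[OF C] algebra_simps)
  from inner_antisym[OF S this] show ?thesis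
    unfolding covector_wedge_def by (simp add: inner_contraction[OF torsion_tensorsD(1)[OF S] C adj])
qed

lemma riesz:
  assumes "linear f"
  obtains u where "\<And>x. g u x = f x"
proof
  fix x
  show "g (\<Sum>b\<in>B. f b *\<^sub>R dual b) x = f x"
    using expand_linear(2)[OF assms, of x]
    by (simp add: form_sum form_sym[of "dual _" x] mult.commute)
qed

lemma independent_triple:
  assumes "\<eta> x = 0" "x \<noteq> 0"
  shows "independent {\<xi>, \<phi> x, x}" "card {\<xi>, \<phi> x, x} = 3"
proof -
  have phi: "\<phi> x \<notin> span {x}"
  proof
    assume "\<phi> x \<in> span {x}"
    then obtain k where k: "\<phi> x = k *\<^sub>R x" by (auto simp: real_vector.span_singleton)
    then have "\<phi> (\<phi> x) = (k * k) *\<^sub>R x" by simp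
    then have "(k * k) *\<^sub>R x = - x" using assms(1) by (simp add: phi_phi)
    then have "(k * k + 1) *\<^sub>R x = 0" by (simp add: scaleR_add_left)
    moreover have "k * k + 1 \<noteq> 0" using zero_le_square[of k] by argo
    ultimately show False using assms(2) by simp
  qed
  have "real_vector.subspace {v. \<eta> v = 0}" by (simp add: real_vector.subspace_def)
  then have "span {\<phi> x, x} \<subseteq> {v. \<eta> v = 0}"
    using assms(1) by (intro real_vector.span_minimal) auto
  then have xi: "\<xi> \<notin> span {\<phi> x, x}" by auto
  show "independent {\<xi>, \<phi> x, x}"
    using xi phi assms(2) by (simp add: real_vector.independent_insert)
  have "\<phi> x \<notin> {x}" "\<xi> \<notin> {\<phi> x, x}" using phi xi
    by (meson real_vector.span_base)+
  then show "card {\<xi>, \<phi> x, x} = 3" by auto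
qed

lemma dimension_one:
  assumes "n = 0" shows "hor x = 0"
proof (rule ccontr)
  assume "hor x \<noteq> 0"
  from independent_triple[OF _ this] have "card {\<xi>, \<phi> (hor x), hor x} = 3" "independent {\<xi>, \<phi> (hor x), hor x}"
    by simp_all
  then show False
    using real_vector.independent_span_bound[OF finite_basis, of "{\<xi>, \<phi> (hor x), hor x}"] card_B assms
      span_basis by simp
qed

text \<open>A tensor of \<open>P11\<close> is complex bilinear and alternating in its first two arguments on \<open>ker \<eta>\<close>, which is a
  complex line if \<open>n = 1\<close>.\<close>

lemma P11_dimension_three:
  assumes "n = 1" and T: "T \<in> P11 \<phi> \<xi>"
  shows "T x y z = 0"
proof (cases "hor x = 0")
  case True
  have "T x y z = T (hor x) y z" using P1_D(6)[OF P11_D(1)[OF T]] by simp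
  then show ?thesis using True trilinear_simps(13)[OF P1_D(2)[OF P11_D(1)[OF T]]] by simp
next
  case False
  note D = P1_D[OF P11_D(1)[OF T]]
  define h where "h = hor x"
  have h: "h \<noteq> 0" "\<eta> h = 0" using False by (simp_all add: h_def)
  note E = independent_triple[OF h(2,1)]
  have "y \<in> span {\<xi>, \<phi> h, h}"
  proof (rule ccontr)
    assume y: "y \<notin> span {\<xi>, \<phi> h, h}"
    then have "independent (insert y {\<xi>, \<phi> h, h})"
      using E(1) by (rule real_vector.independent_insertI)
    from real_vector.independent_span_bound[OF finite_basis this] span_basis
    have "card (insert y {\<xi>, \<phi> h, h}) \<le> card B" by simp
    moreover have "y \<notin> {\<xi>, \<phi> h, h}" using y by (meson real_vector.span_base)
    then have "card (insert y {\<xi>, \<phi> h, h}) = 4" using E(2) by (subst card_insert_disjoint) auto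
    ultimately show False using card_B assms(1) by simp
  qed
  moreover have "real_vector.subspace {v. T h v z = 0}"
    by (simp add: real_vector.subspace_def trilinear_simps[OF D(2)])
  moreover have "T h (\<phi> h) z = 0"
    using P11_D(2)[OF T, of h "\<phi> h" z] D(10)[of "\<phi> h" h z] torsion_tensorsD(2)[OF D(1), of h "\<phi> h" z]
    by argo
  then have "{\<xi>, \<phi> h, h} \<subseteq> {v. T h v z = 0}"
    by (simp add: D(4) torsion_tensorsD(3)[OF D(1)])
  ultimately have "y \<in> {v. T h v z = 0}" by (meson real_vector.span_minimal subsetD)
  then have "T h y z = 0" by simp
  then show ?thesis using D(6) by (simp add: h_def)
qed

lemma orthogonal_split:
  assumes W: "W \<subseteq> torsion_tensors" and W0: "W0 \<subseteq> W" and T: "T - U \<in> W0" and U: "U \<in> W"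
    and orth: "\<And>S. S \<in> W0 \<Longrightarrow> tensor_inner g B S U = 0"
  shows "T \<in> tensor.span (orthogonal_complement_in g B W W0 \<union> W0)"
proof -
  have "tensor_inner g B U S = 0" if "S \<in> W0" for S
    using orth[OF that] inner_commute[of U S] W W0 U that torsion_tensorsD(1) by (metis subsetD)
  then have "U \<in> orthogonal_complement_in g B W W0"
    using U by (simp add: orthogonal_complement_in_def)
  then have "U + (T - U) \<in> tensor.span (orthogonal_complement_in g B W W0 \<union> W0)"
    using T by (intro tensor.span_add) (auto intro: tensor.span_base)
  then show ?thesis by (simp add: fun_eq_iff)
qed

lemma P1_t_vector:
  assumes "T \<in> P1 \<xi>"
  obtains u where "\<eta> u = 0" "\<And>x. g u x = torsion_t g B T x"
proof -
  note tri = P1_D(2)[OF assms]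
  have "linear (torsion_t g B T)"
    unfolding torsion_t_trace[OF tri, abs_def] by (intro linear_trace trilinear_linear[OF tri])
  then obtain u where u: "\<And>x. g u x = torsion_t g B T x" by (rule riesz[OF _ that])
  moreover have "\<eta> u = 0"
    using u[of \<xi>] by (simp add: eta_form(1)[symmetric] torsion_t_def P1_D(3)[OF assms])
  ultimately show thesis using that by blast
qed

lemmas covector_wedge_simps = phi_self_adjoint phi_phi eta_form(1)[symmetric] eta_form(2)[symmetric]

text \<open>With \<open>\<theta> = g(u, \<cdot>)\<close>, this tensor is \<open>\<theta>(x) g(y, z) - \<theta>(\<phi>x) g(y, \<phi>z)\<close> on \<open>ker \<eta>\<close>, antisymmetrized in \<open>x\<close> and
  \<open>y\<close>. It is the real part of the wedge product of the complex linear covector with real part \<open>\<theta>\<close> and the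
  complex bilinear form with real part \<open>g\<close>, as befits the complex trilinear tensors of \<open>P11\<close>.\<close>

lemma P11_trace_tensor:
  assumes u: "\<eta> u = 0"
  shows "covector_wedge u hor - covector_wedge (\<phi> u) \<phi> \<in> P11 \<phi> \<xi>"
    "torsion_t g B (covector_wedge u hor - covector_wedge (\<phi> u) \<phi>) x = (2 * real n - 2) * g u x"
    "S \<in> P11 \<phi> \<xi> \<Longrightarrow> tensor_inner g B S (covector_wedge u hor - covector_wedge (\<phi> u) \<phi>) = 4 * torsion_t g B S u"
proof -
  have "covector_wedge u hor - covector_wedge (\<phi> u) \<phi> \<in> torsion_tensors"
    by (intro tensor.subspace_diff[OF subspace_torsion_tensors] covector_wedge_torsion linear_hor linear_phi)
  then have "covector_wedge u hor - covector_wedge (\<phi> u) \<phi> \<in> P1 \<xi>"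
    by (simp add: P1_def covector_wedge_def covector_wedge_simps u hor_def)
  then show "covector_wedge u hor - covector_wedge (\<phi> u) \<phi> \<in> P11 \<phi> \<xi>"
    by (simp add: P11_def) (simp add: covector_wedge_def covector_wedge_simps u hor_def algebra_simps)
  have "hor u = u" using u by (simp add: hor_def)
  then show "torsion_t g B (covector_wedge u hor - covector_wedge (\<phi> u) \<phi>) x = (2 * real n - 2) * g u x"
    by (simp add: tensor_functionalD[OF tensor_functional_torsion_t(1)] covector_wedge_t linear_hor linear_phi
        trace_hor trace_phi phi_phi u form_sym[of x u] algebra_simps)
  assume S: "S \<in> P11 \<phi> \<xi>"
  note D = P1_D[OF P11_D(1)[OF S]]
  show "tensor_inner g B S (covector_wedge u hor - covector_wedge (\<phi> u) \<phi>) = 4 * torsion_t g B S u"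
    by (simp add: inner_simps inner_covector_wedge[OF D(1)] linear_hor linear_phi hor_self_adjoint
        phi_self_adjoint D(8) P11_D(4)[OF S] trace_minus torsion_t_trace[OF D(2)])
qed

text \<open>The opposite sign arises from the conjugate covector, which makes the tensor real of type \<open>(1, 1)\<close> in
  the first two arguments.\<close>

lemma P13_trace_tensor:
  assumes u: "\<eta> u = 0"
  shows "covector_wedge u hor + covector_wedge (\<phi> u) \<phi> \<in> P13 \<phi> \<xi>"
    "torsion_t g B (covector_wedge u hor + covector_wedge (\<phi> u) \<phi>) x = 2 * real n * g u x"
    "S \<in> P13 \<phi> \<xi> \<Longrightarrow> tensor_inner g B S (covector_wedge u hor + covector_wedge (\<phi> u) \<phi>) = 4 * torsion_t g B S u"
proof -
  have "covector_wedge u hor + covector_wedge (\<phi> u) \<phi> \<in> torsion_tensors"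
    by (intro tensor.subspace_add[OF subspace_torsion_tensors] covector_wedge_torsion linear_hor linear_phi)
  then have P1: "covector_wedge u hor + covector_wedge (\<phi> u) \<phi> \<in> P1 \<xi>"
    by (simp add: P1_def covector_wedge_def covector_wedge_simps u hor_def)
  have sym: "g y (hor x) = g x (hor y)" "g y (\<phi> x) = g x (\<phi> y)" for x y
    using hor_self_adjoint[of x y] phi_self_adjoint[of x y] form_sym[of "hor x" y] form_sym[of "\<phi> x" y]
    by simp_all
  show "covector_wedge u hor + covector_wedge (\<phi> u) \<phi> \<in> P13 \<phi> \<xi>"
    unfolding P13_def mem_Collect_eq
  proof (intro conjI allI P1)
    fix x y z
    show "(covector_wedge u hor + covector_wedge (\<phi> u) \<phi>) x y z = (covector_wedge u hor + covector_wedge (\<phi> u) \<phi>) (\<phi> x) (\<phi> y) z"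
      by (simp add: covector_wedge_def covector_wedge_simps u hor_def algebra_simps)
    show "(covector_wedge u hor + covector_wedge (\<phi> u) \<phi>) x y z + (covector_wedge u hor + covector_wedge (\<phi> u) \<phi>) y z x +
        (covector_wedge u hor + covector_wedge (\<phi> u) \<phi>) z x y = 0"
      by (simp add: covector_wedge_def sym[of x y] sym[of y z] sym[of z x] algebra_simps)
  qed
  have "hor u = u" using u by (simp add: hor_def)
  then show "torsion_t g B (covector_wedge u hor + covector_wedge (\<phi> u) \<phi>) x = 2 * real n * g u x"
    by (simp add: tensor_functionalD[OF tensor_functional_torsion_t(1)] covector_wedge_t linear_hor linear_phi
        trace_hor trace_phi phi_phi u form_sym[of x u] algebra_simps)
  assume S: "S \<in> P13 \<phi> \<xi>"
  note D = P1_D[OF P13_D(1)[OF S]]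
  have "trace (\<lambda>y z. S u (\<phi> y) (\<phi> z)) = trace (\<lambda>y z. S u y (\<phi> (\<phi> z)))"
    by (rule trace_adjoint[of "\<lambda>y z. S u y (\<phi> z)"])
      (auto intro!: linearI simp: trilinear_simps[OF D(2)] phi_self_adjoint)
  also have "\<dots> = - torsion_t g B S u"
    by (simp add: D(11) trace_minus torsion_t_trace[OF D(2)])
  finally have "trace (\<lambda>y z. S u (\<phi> y) (\<phi> z)) = - torsion_t g B S u" .
  moreover have "S u (\<phi> y) (\<phi> z) = - S (\<phi> u) y (\<phi> z)" for y z
    by (rule phi_shift[OF P13_D(1,2)[OF S]])
  ultimately show "tensor_inner g B S (covector_wedge u hor + covector_wedge (\<phi> u) \<phi>) = 4 * torsion_t g B S u"
    by (simp add: inner_simps inner_covector_wedge[OF D(1)] linear_hor linear_phi hor_self_adjoint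
        phi_self_adjoint D(8) trace_minus torsion_t_trace[OF D(2)])
qed

text \<open>Subtracting the multiple of a tensor of \<open>P11_trace_tensor\<close> with the same trace leaves a trace-free one. The factor
  \<open>2 n - 2\<close> vanishes for \<open>n = 1\<close>, where \<open>P11\<close> is zero.\<close>

lemma P11_span: "P11 \<phi> \<xi> \<subseteq> tensor.span (P111 \<phi> \<xi> g B \<union> P112 \<phi> \<xi> g B)"
proof
  fix T assume T: "T \<in> P11 \<phi> \<xi>"
  obtain u where u: "\<eta> u = 0" "\<And>x. g u x = torsion_t g B T x"
    using P1_t_vector[OF P11_D(1)[OF T]] by blast
  let ?D = "covector_wedge u hor - covector_wedge (\<phi> u) \<phi>"
  note D = P11_trace_tensor[OF u(1)]
  show "T \<in> tensor.span (P111 \<phi> \<xi> g B \<union> P112 \<phi> \<xi> g B)"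
    unfolding P111_def
  proof (rule orthogonal_split)
    show "P11 \<phi> \<xi> \<subseteq> torsion_tensors" using P11_D(1) P1_D(1) by blast
    show "P112 \<phi> \<xi> g B \<subseteq> P11 \<phi> \<xi>" unfolding P112_def by blast
    let ?U = "tensor_scale (1 / (2 * real n - 2)) ?D"
    show U: "?U \<in> P11 \<phi> \<xi>" by (intro tensor.subspace_scale subspace_P1x D)
    have "torsion_t g B (T - ?U) x = 0" for x
    proof (cases "n = 1")
      case True
      then have "T - ?U = 0"
        using P11_dimension_three[OF True T] by (simp add: fun_eq_iff)
      then show ?thesis by (simp only: tensor_functionalD[OF tensor_functional_torsion_t(1)])
    next
      case False
      then have "2 * real n - 2 \<noteq> 0" by simp
      then have "1 / (2 * real n - 2) * torsion_t g B ?D x = torsion_t g B T x"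
        unfolding D(2) u(2) by simp
      then show ?thesis
        unfolding tensor_functionalD(4)[OF tensor_functional_torsion_t(1), of _ _ T]
          tensor_functionalD(2)[OF tensor_functional_torsion_t(1)] by simp
    qed
    then show "T - ?U \<in> P112 \<phi> \<xi> g B"
      using tensor.subspace_diff[OF subspace_P1x(1) T U] unfolding P112_def by blast
    show "tensor_inner g B S ?U = 0" if "S \<in> P112 \<phi> \<xi> g B" for S
      using that D(3)[of S] unfolding P112_def by (simp add: inner_simps)
  qed
qed

text \<open>As for \<open>P11\<close>, now with the factor \<open>2 n\<close>; it vanishes only for \<open>n = 0\<close>, when \<open>V\<close> is spanned by \<open>\<xi>\<close>.\<close>

lemma P13_span: "P13 \<phi> \<xi> \<subseteq> tensor.span (P131 \<phi> \<xi> g B \<union> P132 \<phi> \<xi> g B)"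
proof
  fix T assume T: "T \<in> P13 \<phi> \<xi>"
  obtain u where u: "\<eta> u = 0" "\<And>x. g u x = torsion_t g B T x"
    using P1_t_vector[OF P13_D(1)[OF T]] by blast
  let ?D = "covector_wedge u hor + covector_wedge (\<phi> u) \<phi>"
  note D = P13_trace_tensor[OF u(1)]
  show "T \<in> tensor.span (P131 \<phi> \<xi> g B \<union> P132 \<phi> \<xi> g B)"
    unfolding P131_def
  proof (rule orthogonal_split)
    show "P13 \<phi> \<xi> \<subseteq> torsion_tensors" using P13_D(1) P1_D(1) by blast
    show "P132 \<phi> \<xi> g B \<subseteq> P13 \<phi> \<xi>" unfolding P132_def by blast
    let ?U = "tensor_scale (1 / (2 * real n)) ?D"
    show U: "?U \<in> P13 \<phi> \<xi>" by (intro tensor.subspace_scale subspace_P1x D)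
    have "torsion_t g B (T - ?U) x = 0" for x
    proof (cases "n = 0")
      case True
      have "T x y z = 0" for x y z
        using P1_D(6)[OF P13_D(1)[OF T], of x y z] dimension_one[OF True]
          trilinear_simps(13)[OF P1_D(2)[OF P13_D(1)[OF T]]] by simp
      then have "T - ?U = 0" using True by (simp add: fun_eq_iff)
      then show ?thesis by (simp only: tensor_functionalD[OF tensor_functional_torsion_t(1)])
    next
      case False
      then have "1 / (2 * real n) * torsion_t g B ?D x = torsion_t g B T x"
        unfolding D(2) u(2) by simp
      then show ?thesis
        unfolding tensor_functionalD(4)[OF tensor_functional_torsion_t(1), of _ _ T]
          tensor_functionalD(2)[OF tensor_functional_torsion_t(1)] by simp
    qed
    then show "T - ?U \<in> P132 \<phi> \<xi> g B"
      using tensor.subspace_diff[OF subspace_P1x(3) T U] unfolding P132_def by blast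
    show "tensor_inner g B S ?U = 0" if "S \<in> P132 \<phi> \<xi> g B" for S
      using that D(3)[of S] unfolding P132_def by (simp add: inner_simps)
  qed
qed

lemma P31_D:
  assumes "T \<in> P31 \<phi> \<xi> \<eta>"
  shows "T \<in> P3 \<phi> \<xi> \<eta>" "T \<xi> z y = T \<xi> y z" "T \<xi> (\<phi> y) (\<phi> z) = - T \<xi> y z"
proof -
  show "T \<in> P3 \<phi> \<xi> \<eta>" using assms unfolding P31_def by blast
  have "T \<xi> y z = T \<xi> z y" "T \<xi> y z = - T \<xi> (\<phi> y) (\<phi> z)" for y z
    using assms unfolding P31_def by blast+
  from this(1)[of z y] this(2)[of y z] show "T \<xi> z y = T \<xi> y z" "T \<xi> (\<phi> y) (\<phi> z) = - T \<xi> y z"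
    by simp_all
qed

lemma P3_torsion_forms:
  assumes "T \<in> P3 \<phi> \<xi> \<eta>"
  shows "torsion_t g B T x = \<eta> x * torsion_t g B T \<xi>"
    "torsion_t_star \<phi> g B T x = \<eta> x * torsion_t_star \<phi> g B T \<xi>"
proof -
  note D = P3_D[OF assms] and simps = trilinear_simps[OF P3_D(2)[OF assms]]
  have eq: "T x i z = \<eta> x * T \<xi> i z - g \<xi> i * T \<xi> x z" for i z
    using D(6)[of x i z] by (simp add: eta_form(2)[symmetric])
  have lin: "linear (\<lambda>z. T \<xi> x z)" "linear (\<lambda>z. T \<xi> x (\<phi> z))"
    by (rule linearI; simp add: simps)+
  show "torsion_t g B T x = \<eta> x * torsion_t g B T \<xi>"
    unfolding torsion_t_trace[OF D(2)]
    by (subst eq[abs_def], unfold trace_diff trace_scale trace_product[OF lin(1)]) (simp add: D(4))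
  show "torsion_t_star \<phi> g B T x = \<eta> x * torsion_t_star \<phi> g B T \<xi>"
    unfolding torsion_t_star_trace[OF D(2)]
    by (subst eq, unfold trace_diff trace_scale trace_product[OF lin(2)]) (simp add: simps)
qed

text \<open>These two tensors span the trace part of \<open>P31\<close>: pairing with them recovers the two torsion forms at
  \<open>\<xi>\<close>, and as \<open>\<phi>\<close> has trace zero for each of them one of the two forms vanishes.\<close>

lemma P31_trace_tensors:
  "covector_wedge \<xi> hor \<in> P31 \<phi> \<xi> \<eta>" "covector_wedge \<xi> \<phi> \<in> P31 \<phi> \<xi> \<eta>"
  "torsion_t g B (covector_wedge \<xi> hor) x = 2 * real n * \<eta> x" "torsion_t g B (covector_wedge \<xi> \<phi>) x = 0"
  "torsion_t_star \<phi> g B (covector_wedge \<xi> hor) x = 0"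
  "torsion_t_star \<phi> g B (covector_wedge \<xi> \<phi>) x = - 2 * real n * \<eta> x"
  "S \<in> P3 \<phi> \<xi> \<eta> \<Longrightarrow> tensor_inner g B S (covector_wedge \<xi> hor) = 2 * torsion_t g B S \<xi>"
  "S \<in> P3 \<phi> \<xi> \<eta> \<Longrightarrow> tensor_inner g B S (covector_wedge \<xi> \<phi>) = 2 * torsion_t_star \<phi> g B S \<xi>"
proof -
  have wedge: "covector_wedge \<xi> C = eta_wedge (\<lambda>y z. g y (C z))" for C
    by (simp add: covector_wedge_def eta_wedge_def eta_form(2))
  have sym: "g y (hor x) = g x (hor y)" "g y (\<phi> x) = g x (\<phi> y)" for x y
    using hor_self_adjoint[of x y] phi_self_adjoint[of x y] form_sym[of "hor x" y] form_sym[of "\<phi> x" y]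
    by simp_all
  have P3: "covector_wedge \<xi> hor \<in> P3 \<phi> \<xi> \<eta>" "covector_wedge \<xi> \<phi> \<in> P3 \<phi> \<xi> \<eta>"
    unfolding wedge
    by (rule eta_wedge_P3; (rule linearI)?;
        simp add: linear_add[OF linear_hor] linear_scale[OF linear_hor] eta_form(2)[symmetric])+
  have eval: "covector_wedge \<xi> C \<xi> y z = g y (C z) - \<eta> y * \<eta> (C z)" for C y z
    by (simp add: covector_wedge_def eta_form(2)[symmetric])
  have "covector_wedge \<xi> hor \<xi> y z = covector_wedge \<xi> hor \<xi> z y" "covector_wedge \<xi> \<phi> \<xi> y z = covector_wedge \<xi> \<phi> \<xi> z y"
    "covector_wedge \<xi> hor \<xi> y z = - covector_wedge \<xi> hor \<xi> (\<phi> y) (\<phi> z)"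
    "covector_wedge \<xi> \<phi> \<xi> y z = - covector_wedge \<xi> \<phi> \<xi> (\<phi> y) (\<phi> z)" for y z
    using form_sym[of y z] sym(2)[of y z] by (simp_all add: eval covector_wedge_simps hor_def)
  then show "covector_wedge \<xi> hor \<in> P31 \<phi> \<xi> \<eta>" "covector_wedge \<xi> \<phi> \<in> P31 \<phi> \<xi> \<eta>"
    unfolding P31_def using P3 by blast+
  show "torsion_t g B (covector_wedge \<xi> hor) x = 2 * real n * \<eta> x" "torsion_t g B (covector_wedge \<xi> \<phi>) x = 0"
    "torsion_t_star \<phi> g B (covector_wedge \<xi> hor) x = 0"
    "torsion_t_star \<phi> g B (covector_wedge \<xi> \<phi>) x = - 2 * real n * \<eta> x"
    by (simp_all add: covector_wedge_t linear_hor linear_phi trace_hor trace_phi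
        trace_phi_phi eta_form(2)[symmetric] linear_0[OF linear_hor])
  assume "S \<in> P3 \<phi> \<xi> \<eta>"
  note D = P3_D[OF this]
  have "S x y (hor z) = S x y z" for x y z
    by (simp add: hor_def trilinear_simps[OF D(2)] D(4))
  then show "tensor_inner g B S (covector_wedge \<xi> hor) = 2 * torsion_t g B S \<xi>"
    "tensor_inner g B S (covector_wedge \<xi> \<phi>) = 2 * torsion_t_star \<phi> g B S \<xi>"
    by (simp_all add: inner_covector_wedge[OF D(1)] linear_hor linear_phi hor_self_adjoint
        phi_self_adjoint torsion_t_trace[OF D(2)] torsion_t_star_trace[OF D(2)])
qed

lemma P31_dimension_one:
  assumes "n = 0" and T: "T \<in> P31 \<phi> \<xi> \<eta>"
  shows "T = 0"
proof -
  note D = P3_D[OF P31_D(1)[OF T]]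
  have "\<phi> y = 0" for y
    using dimension_one[OF assms(1), of y] hor_simps(3)[of y] by simp
  then have "T \<xi> y z = 0" for y z
    using P31_D(3)[OF T, of y z] by (simp add: trilinear_simps[OF D(2)])
  then have "T x y z = 0" for x y z using D(6)[of x y z] by simp
  then show ?thesis by (simp add: fun_eq_iff)
qed

text \<open>For \<open>n = 0\<close> the coefficients are divisions by zero, harmless because \<open>P31\<close> is then zero.\<close>

lemma P31_remove_traces:
  assumes T: "T \<in> P31 \<phi> \<xi> \<eta>"
  shows "T - tensor_scale (torsion_t g B T \<xi> / (2 * real n)) (covector_wedge \<xi> hor)
      - tensor_scale (- torsion_t_star \<phi> g B T \<xi> / (2 * real n)) (covector_wedge \<xi> \<phi>) \<in> P313 \<phi> \<xi> \<eta> g B"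
    (is "T - ?U - ?V \<in> _")
proof -
  have UV: "?U \<in> P31 \<phi> \<xi> \<eta>" "?V \<in> P31 \<phi> \<xi> \<eta>"
    by (intro tensor.subspace_scale subspace_P3x P31_trace_tensors)+
  have "torsion_t g B (T - ?U - ?V) x = 0 \<and> torsion_t_star \<phi> g B (T - ?U - ?V) x = 0" for x
  proof (cases "n = 0")
    case True
    then have "T - ?U - ?V = 0"
      using P31_dimension_one[OF True T] by (simp add: fun_eq_iff)
    then show ?thesis
      by (simp only: tensor_functionalD[OF tensor_functional_torsion_t(1)]
          tensor_functionalD[OF tensor_functional_torsion_t(2)] simp_thms)
  next
    case False
    then show ?thesis
      using P3_torsion_forms[OF P31_D(1)[OF T], of x]
      by (simp add: tensor_functionalD[OF tensor_functional_torsion_t(1)]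
          tensor_functionalD[OF tensor_functional_torsion_t(2)] P31_trace_tensors)
  qed
  then show ?thesis
    using tensor.subspace_diff[OF subspace_P3x(1) tensor.subspace_diff[OF subspace_P3x(1) T UV(1)] UV(2)]
    unfolding P313_def by blast
qed

lemma P313_D:
  assumes "S \<in> P313 \<phi> \<xi> \<eta> g B"
  shows "S \<in> P31 \<phi> \<xi> \<eta>" "torsion_t g B S x = 0" "torsion_t_star \<phi> g B S x = 0"
  using assms unfolding P313_def by blast+

lemma P31_span: "P31 \<phi> \<xi> \<eta> \<subseteq> tensor.span (P311 \<phi> \<xi> \<eta> g B \<union> P312 \<phi> \<xi> \<eta> g B \<union> P313 \<phi> \<xi> \<eta> g B)"
proof
  fix T assume T: "T \<in> P31 \<phi> \<xi> \<eta>"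
  let ?X = "P311 \<phi> \<xi> \<eta> g B \<union> P312 \<phi> \<xi> \<eta> g B \<union> P313 \<phi> \<xi> \<eta> g B"
  note D = P31_trace_tensors
  have tri: "trilinear S" if "S \<in> P31 \<phi> \<xi> \<eta>" for S using P3_D(2)[OF P31_D(1)[OF that]] .
  have orth: "tensor_inner g B (covector_wedge \<xi> hor) S = 0" "tensor_inner g B (covector_wedge \<xi> \<phi>) S = 0"
    if "S \<in> P313 \<phi> \<xi> \<eta> g B" for S
    using D(7,8)[OF P31_D(1)[OF P313_D(1)[OF that]]] P313_D[OF that]
      inner_commute[OF tri[OF D(1)] tri[OF P313_D(1)[OF that]]]
      inner_commute[OF tri[OF D(2)] tri[OF P313_D(1)[OF that]]] by simp_all
  have "covector_wedge \<xi> hor \<in> P311 \<phi> \<xi> \<eta> g B" "covector_wedge \<xi> \<phi> \<in> P312 \<phi> \<xi> \<eta> g B"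
    using D orth by (simp_all add: P311_def P312_def orthogonal_complement_in_def)
  moreover have "T = tensor_scale (torsion_t g B T \<xi> / (2 * real n)) (covector_wedge \<xi> hor)
      + tensor_scale (- torsion_t_star \<phi> g B T \<xi> / (2 * real n)) (covector_wedge \<xi> \<phi>)
      + (T - tensor_scale (torsion_t g B T \<xi> / (2 * real n)) (covector_wedge \<xi> hor)
      - tensor_scale (- torsion_t_star \<phi> g B T \<xi> / (2 * real n)) (covector_wedge \<xi> \<phi>))"
    by (simp add: fun_eq_iff)
  moreover have "\<dots> \<in> tensor.span ?X"
    using calculation(1,2) P31_remove_traces[OF T]
    by (intro tensor.span_add tensor.span_scale) (auto intro: tensor.span_base)
  ultimately show "T \<in> tensor.span ?X" by simp
qed

text \<open>Up to an element of \<open>P313\<close>, to which \<open>P311\<close> is orthogonal, a tensor of \<open>P312\<close> is a multiple of the tensor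
  whose pairing with \<open>S\<close> is given by the form \<open>t\<^sup>*\<close> of \<open>S\<close>, which vanishes on \<open>P311\<close>.\<close>

lemma orthogonal_P311_P312: "perpendicular (P311 \<phi> \<xi> \<eta> g B) (P312 \<phi> \<xi> \<eta> g B)"
  unfolding perpendicular_def
proof (intro ballI)
  fix S T assume S: "S \<in> P311 \<phi> \<xi> \<eta> g B" and T: "T \<in> P312 \<phi> \<xi> \<eta> g B"
  have S': "S \<in> P31 \<phi> \<xi> \<eta>" "\<And>x. torsion_t_star \<phi> g B S x = 0"
    "\<And>R. R \<in> P313 \<phi> \<xi> \<eta> g B \<Longrightarrow> tensor_inner g B S R = 0"
    using S unfolding P311_def orthogonal_complement_in_def by blast+
  have T': "T \<in> P31 \<phi> \<xi> \<eta>" "\<And>x. torsion_t g B T x = 0"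
    using T unfolding P312_def orthogonal_complement_in_def by blast+
  from S'(3)[OF P31_remove_traces[OF T'(1)]] show "tensor_inner g B S T = 0"
    by (simp add: inner_simps T'(2) S'(2) P31_trace_tensors(8)[OF P31_D(1)[OF S'(1)]])
qed


section \<open>Invariance under the structure group\<close>

lemma structure_groupD:
  assumes "a \<in> structure_group \<phi> \<xi> \<eta> g"
  shows "linear a" "bij a" "a (\<phi> x) = \<phi> (a x)" "a \<xi> = \<xi>" "\<eta> (a x) = \<eta> x" "g (a x) (a y) = g x y"
    "inv a (a x) = x" "a (inv a x) = x"
  using assms unfolding structure_group_def by (auto simp: bij_is_inj bij_is_surj surj_f_inv_f)

lemma structure_group_inv:
  assumes "a \<in> structure_group \<phi> \<xi> \<eta> g"
  shows "inv a \<in> structure_group \<phi> \<xi> \<eta> g"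
proof -
  note D = structure_groupD[OF assms]
  have eqI: "x = y" if "a x = a y" for x y using D(7) that by metis
  have "linear (inv a)"
    by (rule linearI; rule eqI) (simp_all add: linear_add[OF D(1)] linear_scale[OF D(1)] D(8))
  moreover have "inv a (\<phi> x) = \<phi> (inv a x)" for x by (rule eqI) (simp add: D(3,8))
  moreover have "inv a \<xi> = \<xi>" by (rule eqI) (simp add: D(4,8))
  moreover have "\<eta> (inv a x) = \<eta> x" for x using D(5)[of "inv a x"] by (simp add: D(8))
  moreover have "g (inv a x) (inv a y) = g x y" for x y
    using D(6)[of "inv a x" "inv a y"] by (simp add: D(8))
  ultimately show ?thesis
    unfolding structure_group_def using bij_imp_bij_inv[OF D(2)] by blast
qed

lemma
  assumes a: "a \<in> structure_group \<phi> \<xi> \<eta> g" and T: "trilinear T"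
  shows torsion_t_action: "torsion_t g B (group_action a T) x = torsion_t g B T (inv a x)"
    and torsion_t_star_action:
      "torsion_t_star \<phi> g B (group_action a T) x = torsion_t_star \<phi> g B T (inv a x)"
    and inner_action: "trilinear S \<Longrightarrow>
      tensor_inner g B (group_action a T) S = tensor_inner g B T (group_action (inv a) S)"
proof -
  note b = structure_groupD[OF structure_group_inv[OF a]] and D = structure_groupD[OF a]
  have inv: "inv (inv a) = a" using D(2) by (rule inv_inv_eq)
  have adj: "g (inv a x) y = g x (a y)" for x y
    using D(6)[of "inv a x" y] by (simp add: D(8))
  have tri: "trilinear (group_action a T)"
    unfolding group_action_def by (rule trilinear_slots[OF T b(1,1,1)])
  have 1: "trace (\<lambda>y z. T x (inv a y) (C (inv a z))) = trace (\<lambda>y z. T x y (C z))"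
    if "linear C" for C x
  proof -
    have "trace (\<lambda>y z. T x (inv a y) (C (inv a z))) = trace (\<lambda>y z. T x y (C (inv a (a z))))"
      by (rule trace_adjoint[of "\<lambda>y z. T x y (C (inv a z))"])
        (auto intro!: linearI simp: trilinear_simps[OF T] linear_add[OF that] linear_scale[OF that]
          linear_add[OF b(1)] linear_scale[OF b(1)] adj)
    then show ?thesis by (simp add: D(7))
  qed
  show "torsion_t g B (group_action a T) x = torsion_t g B T (inv a x)"
    unfolding torsion_t_trace[OF tri] torsion_t_trace[OF T]
    using 1[OF linear_ident] by (simp add: group_action_def)
  show "torsion_t_star \<phi> g B (group_action a T) x = torsion_t_star \<phi> g B T (inv a x)"
    unfolding torsion_t_star_trace[OF tri] torsion_t_star_trace[OF T]
    using 1[OF linear_phi] by (simp add: group_action_def b(3))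
  show "tensor_inner g B (group_action a T) S = tensor_inner g B T (group_action (inv a) S)"
    if "trilinear S"
    unfolding group_action_def inv
    by (rule inner_slots[OF T that D(1,1,1)]) (rule adj)+
qed

definition invariant :: "'v tensor3 set \<Rightarrow> bool" where
  "invariant W \<longleftrightarrow> (\<forall>a\<in>structure_group \<phi> \<xi> \<eta> g. \<forall>T\<in>W. group_action a T \<in> W)"

lemma invariantI:
  assumes "\<And>a T. \<lbrakk>inv a \<in> structure_group \<phi> \<xi> \<eta> g; a \<in> structure_group \<phi> \<xi> \<eta> g; T \<in> W\<rbrakk>
    \<Longrightarrow> group_action a T \<in> W"
  shows "invariant W"
  using assms structure_group_inv unfolding invariant_def by blast

lemma invariant_torsion: "invariant torsion_tensors"
proof (rule invariantI)
  fix a and T :: "'v tensor3"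
  assume a: "inv a \<in> structure_group \<phi> \<xi> \<eta> g" and T: "T \<in> torsion_tensors"
  show "group_action a T \<in> torsion_tensors"
    unfolding group_action_def
    by (rule torsion_tensors_slots[OF T structure_groupD(1)[OF a] structure_groupD(1)[OF a]])
qed

text \<open>Conditions on \<open>T\<close> built from \<open>\<phi>\<close>, \<open>\<xi>\<close> and \<open>\<eta>\<close> pass to the transformed tensor by substituting the
  images of the arguments under \<open>inv a\<close>.\<close>

lemma invariant_P1: "invariant (P1 \<xi>)"
proof (rule invariantI)
  fix a T assume a: "inv a \<in> structure_group \<phi> \<xi> \<eta> g" "a \<in> structure_group \<phi> \<xi> \<eta> g" and T: "T \<in> P1 \<xi>"
  note b = structure_groupD(3-5)[OF a(1)]
  have "group_action a T \<in> torsion_tensors"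
    using invariant_torsion a(2) P1_D(1)[OF T] unfolding invariant_def by blast
  then show "group_action a T \<in> P1 \<xi>"
    by (simp add: P1_def group_action_def b P1_D(3,5)[OF T])
qed

lemma invariant_P1x:
  "invariant (P11 \<phi> \<xi>)" "invariant (P12 \<phi> \<xi>)" "invariant (P13 \<phi> \<xi>)" "invariant (P14 \<phi> \<xi>)"
proof -
  have *: "group_action a T \<in> P1 \<xi>" if "T \<in> P1 \<xi>" "a \<in> structure_group \<phi> \<xi> \<eta> g" for a T
    using invariant_P1 that unfolding invariant_def by blast
  note b = structure_groupD(3)
  show "invariant (P11 \<phi> \<xi>)" "invariant (P12 \<phi> \<xi>)" "invariant (P13 \<phi> \<xi>)" "invariant (P14 \<phi> \<xi>)"
    by (rule invariantI; unfold P11_def P12_def P13_def P14_def mem_Collect_eq;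
      elim conjE; intro conjI allI; (rule *; assumption)?; unfold group_action_def b; blast)+
qed

lemma invariant_P2_P3_P41: "invariant (P2 \<phi> \<xi> \<eta>)" "invariant (P3 \<phi> \<xi> \<eta>)" "invariant (P41 \<xi> \<eta>)"
proof -
  have *: "group_action a T \<in> torsion_tensors"
    if "T \<in> torsion_tensors" "a \<in> structure_group \<phi> \<xi> \<eta> g" for a T
    using invariant_torsion that unfolding invariant_def by blast
  have trans: "inv a (\<phi> (\<phi> x)) = \<phi> (\<phi> (inv a x))" "inv a \<xi> = \<xi>" "\<eta> x = \<eta> (inv a x)"
    if "inv a \<in> structure_group \<phi> \<xi> \<eta> g" for a x
    using structure_groupD(3-5)[OF that] by simp_all
  show "invariant (P2 \<phi> \<xi> \<eta>)"
  proof (rule invariantI)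
    fix a T assume a: "inv a \<in> structure_group \<phi> \<xi> \<eta> g" "a \<in> structure_group \<phi> \<xi> \<eta> g"
      and T: "T \<in> P2 \<phi> \<xi> \<eta>"
    have "T x y z = \<eta> z * T (\<phi> (\<phi> x)) (\<phi> (\<phi> y)) \<xi>" for x y z
      using T unfolding P2_def by blast
    from this[of "inv a _" "inv a _" "inv a _"] *[OF P2_D(1)[OF T] a(2)]
    show "group_action a T \<in> P2 \<phi> \<xi> \<eta>"
      unfolding P2_def mem_Collect_eq group_action_def structure_groupD(3-5)[OF a(1)] by blast
  qed
  show "invariant (P3 \<phi> \<xi> \<eta>)"
  proof (rule invariantI)
    fix a T assume a: "inv a \<in> structure_group \<phi> \<xi> \<eta> g" "a \<in> structure_group \<phi> \<xi> \<eta> g"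
      and T: "T \<in> P3 \<phi> \<xi> \<eta>"
    have "T x y z = \<eta> x * T \<xi> (\<phi> (\<phi> y)) (\<phi> (\<phi> z)) - \<eta> y * T \<xi> (\<phi> (\<phi> x)) (\<phi> (\<phi> z))" for x y z
      using T unfolding P3_def by blast
    from this[of "inv a _" "inv a _" "inv a _"] *[OF P3_D(1)[OF T] a(2)]
    show "group_action a T \<in> P3 \<phi> \<xi> \<eta>"
      unfolding P3_def mem_Collect_eq group_action_def structure_groupD(3-5)[OF a(1)] by blast
  qed
  show "invariant (P41 \<xi> \<eta>)"
  proof (rule invariantI)
    fix a T assume a: "inv a \<in> structure_group \<phi> \<xi> \<eta> g" "a \<in> structure_group \<phi> \<xi> \<eta> g"
      and T: "T \<in> P41 \<xi> \<eta>"
    have "T x y z = \<eta> z * (\<eta> y * T x \<xi> \<xi> - \<eta> x * T y \<xi> \<xi>)" for x y z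
      using T unfolding P41_def torsion_t_hat_def by blast
    from this[of "inv a _" "inv a _" "inv a _"] *[OF P41_D(1)[OF T] a(2)]
    show "group_action a T \<in> P41 \<xi> \<eta>"
      unfolding P41_def torsion_t_hat_def mem_Collect_eq group_action_def
        structure_groupD(4,5)[OF a(1)] by blast
  qed
qed

lemma invariant_P2x: "invariant (P21 \<phi> \<xi> \<eta>)" "invariant (P22 \<phi> \<xi> \<eta>)"
proof -
  have *: "group_action a T \<in> P2 \<phi> \<xi> \<eta>" if "T \<in> P2 \<phi> \<xi> \<eta>" "a \<in> structure_group \<phi> \<xi> \<eta> g" for a T
    using invariant_P2_P3_P41(1) that unfolding invariant_def by blast
  note b = structure_groupD(3,4)
  show "invariant (P21 \<phi> \<xi> \<eta>)" "invariant (P22 \<phi> \<xi> \<eta>)"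
    by (rule invariantI; unfold P21_def P22_def mem_Collect_eq;
      elim conjE; intro conjI allI; (rule *; assumption)?; unfold group_action_def b; blast)+
qed

lemma invariant_P3x: "invariant (P31 \<phi> \<xi> \<eta>)" "invariant (P32 \<phi> \<xi> \<eta>)" "invariant (P33 \<phi> \<xi> \<eta>)"
  "invariant (P34 \<phi> \<xi> \<eta>)"
proof -
  have *: "group_action a T \<in> P3 \<phi> \<xi> \<eta>" if "T \<in> P3 \<phi> \<xi> \<eta>" "a \<in> structure_group \<phi> \<xi> \<eta> g" for a T
    using invariant_P2_P3_P41(2) that unfolding invariant_def by blast
  note b = structure_groupD(3,4)
  show "invariant (P31 \<phi> \<xi> \<eta>)" "invariant (P32 \<phi> \<xi> \<eta>)" "invariant (P33 \<phi> \<xi> \<eta>)" "invariant (P34 \<phi> \<xi> \<eta>)"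
    by (rule invariantI; unfold P31_def P32_def P33_def P34_def mem_Collect_eq;
      elim conjE; intro conjI allI; (rule *; assumption)?; unfold group_action_def b; blast)+
qed

text \<open>By \<open>inner_action\<close>, moving \<open>a\<close> across the inner product lets \<open>inv a\<close> act on the smaller space.\<close>

lemma invariant_orthogonal_complement:
  assumes W: "invariant W" "W \<subseteq> torsion_tensors" and W0: "invariant W0" "W0 \<subseteq> torsion_tensors"
  shows "invariant (orthogonal_complement_in g B W W0)"
proof (rule invariantI)
  fix a T assume a: "inv a \<in> structure_group \<phi> \<xi> \<eta> g" "a \<in> structure_group \<phi> \<xi> \<eta> g"
    and T: "T \<in> orthogonal_complement_in g B W W0"
  then have T': "T \<in> W" "\<And>S. S \<in> W0 \<Longrightarrow> tensor_inner g B T S = 0"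
    by (auto simp: orthogonal_complement_in_def)
  have "tensor_inner g B (group_action a T) S = 0" if "S \<in> W0" for S
  proof -
    have "group_action (inv a) S \<in> W0" using W0(1) a(1) that unfolding invariant_def by blast
    moreover have "trilinear T" "trilinear S"
      using T'(1) W(2) W0(2) that torsion_tensorsD(1) by (meson subsetD)+
    ultimately show ?thesis by (simp add: inner_action[OF a(2)] T'(2))
  qed
  moreover have "group_action a T \<in> W" using W(1) a(2) T'(1) unfolding invariant_def by blast
  ultimately show "group_action a T \<in> orthogonal_complement_in g B W W0"
    by (simp add: orthogonal_complement_in_def)
qed

lemma invariant_torsion_forms:
  assumes W: "invariant W" "W \<subseteq> torsion_tensors"
  shows "invariant {T \<in> W. \<forall>x. torsion_t g B T x = 0}"
    "invariant {T \<in> W. \<forall>x. torsion_t_star \<phi> g B T x = 0}"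
    "invariant {T \<in> W. (\<forall>x. torsion_t g B T x = 0) \<and> (\<forall>x. torsion_t_star \<phi> g B T x = 0)}"
proof -
  have tri: "trilinear T" if "T \<in> W" for T using W(2) that torsion_tensorsD(1) by (meson subsetD)
  have "group_action a T \<in> W" if "T \<in> W" "a \<in> structure_group \<phi> \<xi> \<eta> g" for a T
    using W(1) that unfolding invariant_def by blast
  then show "invariant {T \<in> W. \<forall>x. torsion_t g B T x = 0}"
    "invariant {T \<in> W. \<forall>x. torsion_t_star \<phi> g B T x = 0}"
    "invariant {T \<in> W. (\<forall>x. torsion_t g B T x = 0) \<and> (\<forall>x. torsion_t_star \<phi> g B T x = 0)}"
    unfolding invariant_def by (simp_all add: torsion_t_action torsion_t_star_action tri)
qed

lemma P_subsets:
  "P11 \<phi> \<xi> \<subseteq> P1 \<xi>" "P12 \<phi> \<xi> \<subseteq> P1 \<xi>" "P13 \<phi> \<xi> \<subseteq> P1 \<xi>" "P14 \<phi> \<xi> \<subseteq> P1 \<xi>"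
  "P21 \<phi> \<xi> \<eta> \<subseteq> P2 \<phi> \<xi> \<eta>" "P22 \<phi> \<xi> \<eta> \<subseteq> P2 \<phi> \<xi> \<eta>"
  "P31 \<phi> \<xi> \<eta> \<subseteq> P3 \<phi> \<xi> \<eta>" "P32 \<phi> \<xi> \<eta> \<subseteq> P3 \<phi> \<xi> \<eta>" "P33 \<phi> \<xi> \<eta> \<subseteq> P3 \<phi> \<xi> \<eta>" "P34 \<phi> \<xi> \<eta> \<subseteq> P3 \<phi> \<xi> \<eta>"
  "P111 \<phi> \<xi> g B \<subseteq> P11 \<phi> \<xi>" "P112 \<phi> \<xi> g B \<subseteq> P11 \<phi> \<xi>"
  "P131 \<phi> \<xi> g B \<subseteq> P13 \<phi> \<xi>" "P132 \<phi> \<xi> g B \<subseteq> P13 \<phi> \<xi>"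
  "P311 \<phi> \<xi> \<eta> g B \<subseteq> P31 \<phi> \<xi> \<eta>" "P312 \<phi> \<xi> \<eta> g B \<subseteq> P31 \<phi> \<xi> \<eta>" "P313 \<phi> \<xi> \<eta> g B \<subseteq> P31 \<phi> \<xi> \<eta>"
  "P1 \<xi> \<subseteq> torsion_tensors" "P2 \<phi> \<xi> \<eta> \<subseteq> torsion_tensors" "P3 \<phi> \<xi> \<eta> \<subseteq> torsion_tensors"
  "P41 \<xi> \<eta> \<subseteq> torsion_tensors"
  unfolding P11_def P12_def P13_def P14_def P21_def P22_def P31_def P32_def P33_def P34_def
    P111_def P112_def P131_def P132_def P311_def P312_def P313_def orthogonal_complement_in_def
    P1_def P2_def P3_def P41_def
  by blast+

lemma invariant_trace_parts:
  "invariant (P112 \<phi> \<xi> g B)" "invariant (P132 \<phi> \<xi> g B)" "invariant (P313 \<phi> \<xi> \<eta> g B)"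
  "invariant (P111 \<phi> \<xi> g B)" "invariant (P131 \<phi> \<xi> g B)" "invariant (P311 \<phi> \<xi> \<eta> g B)"
  "invariant (P312 \<phi> \<xi> \<eta> g B)"
proof -
  have tor: "P11 \<phi> \<xi> \<subseteq> torsion_tensors" "P13 \<phi> \<xi> \<subseteq> torsion_tensors" "P31 \<phi> \<xi> \<eta> \<subseteq> torsion_tensors"
    using P_subsets by (meson subset_trans)+
  then have tor0: "P112 \<phi> \<xi> g B \<subseteq> torsion_tensors" "P132 \<phi> \<xi> g B \<subseteq> torsion_tensors"
    "P313 \<phi> \<xi> \<eta> g B \<subseteq> torsion_tensors"
    using P_subsets by (meson subset_trans)+
  show inv: "invariant (P112 \<phi> \<xi> g B)" "invariant (P132 \<phi> \<xi> g B)" "invariant (P313 \<phi> \<xi> \<eta> g B)"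
    unfolding P112_def P132_def P313_def
    by (intro invariant_torsion_forms invariant_P1x invariant_P3x tor)+
  show "invariant (P111 \<phi> \<xi> g B)" "invariant (P131 \<phi> \<xi> g B)"
    unfolding P111_def P131_def
    by (intro invariant_orthogonal_complement inv invariant_P1x tor tor0)+
  have "invariant (orthogonal_complement_in g B (P31 \<phi> \<xi> \<eta>) (P313 \<phi> \<xi> \<eta> g B))"
    by (intro invariant_orthogonal_complement inv invariant_P3x tor tor0)
  moreover have "orthogonal_complement_in g B (P31 \<phi> \<xi> \<eta>) (P313 \<phi> \<xi> \<eta> g B) \<subseteq> torsion_tensors"
    using tor(3) unfolding orthogonal_complement_in_def by blast
  ultimately show "invariant (P311 \<phi> \<xi> \<eta> g B)" "invariant (P312 \<phi> \<xi> \<eta> g B)"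
    unfolding P311_def P312_def by (rule invariant_torsion_forms)+
qed

section \<open>The decomposition theorem\<close>

text \<open>The list is broken up according to \<open>P1\<close>, \<open>P2\<close>, \<open>P3\<close> and \<open>P41\<close>; orthogonality across these four blocks is
  inherited from the blocks themselves.\<close>

definition classes :: "'v tensor3 set list" where
  "classes = [P111 \<phi> \<xi> g B, P112 \<phi> \<xi> g B, P12 \<phi> \<xi>, P131 \<phi> \<xi> g B, P132 \<phi> \<xi> g B, P14 \<phi> \<xi>] @
     [P21 \<phi> \<xi> \<eta>, P22 \<phi> \<xi> \<eta>] @
     [P311 \<phi> \<xi> \<eta> g B, P312 \<phi> \<xi> \<eta> g B, P313 \<phi> \<xi> \<eta> g B, P32 \<phi> \<xi> \<eta>, P33 \<phi> \<xi> \<eta>, P34 \<phi> \<xi> \<eta>] @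
     [P41 \<xi> \<eta>]"

lemma torsion_class_nth: "torsion_class \<phi> \<xi> \<eta> g B i = classes ! (i - 1)"
  by (simp add: torsion_class_def classes_def)

lemma length_classes: "length classes = 15"
  by (simp add: classes_def)

lemma classes_subspace: "W \<in> set classes \<Longrightarrow> tensor.subspace W"
  by (auto simp: classes_def subspace_trace_parts subspace_P1x subspace_P2x subspace_P3x subspace_P41)

lemma classes_torsion: "W \<in> set classes \<Longrightarrow> W \<subseteq> torsion_tensors"
  unfolding classes_def using P_subsets by (simp, elim disjE; meson subset_trans)

lemma classes_invariant: "W \<in> set classes \<Longrightarrow> invariant W"
  by (auto simp: classes_def invariant_trace_parts invariant_P1x invariant_P2x invariant_P3x invariant_P2_P3_P41)

lemma classes_span: "torsion_tensors \<subseteq> tensor.span (\<Union>(set classes))"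
proof -
  let ?Z = "tensor.span (\<Union>(set classes))"
  have base: "W \<subseteq> ?Z" if "W \<in> set classes" for W
    using that tensor.span_base by blast
  have sub: "X \<subseteq> ?Z" if "X \<subseteq> tensor.span Y" "Y \<subseteq> ?Z" for X Y
    using that tensor.span_minimal[OF that(2) tensor.subspace_span] by blast
  have trace_split: "P11 \<phi> \<xi> \<subseteq> ?Z" "P13 \<phi> \<xi> \<subseteq> ?Z" "P31 \<phi> \<xi> \<eta> \<subseteq> ?Z"
    by (rule sub[OF P11_span] sub[OF P13_span] sub[OF P31_span];
        intro Un_least base; simp add: classes_def)+
  have others: "P12 \<phi> \<xi> \<subseteq> ?Z" "P14 \<phi> \<xi> \<subseteq> ?Z" "P21 \<phi> \<xi> \<eta> \<subseteq> ?Z" "P22 \<phi> \<xi> \<eta> \<subseteq> ?Z"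
    "P32 \<phi> \<xi> \<eta> \<subseteq> ?Z" "P33 \<phi> \<xi> \<eta> \<subseteq> ?Z" "P34 \<phi> \<xi> \<eta> \<subseteq> ?Z" "P41 \<xi> \<eta> \<subseteq> ?Z"
    by (rule base, simp add: classes_def)+
  have 1: "T \<in> ?Z" if "T \<in> P1 \<xi>" for T
    using that
    by (rule P1_decomposition) (use trace_split others in \<open>auto intro!: tensor.span_add\<close>)
  have 2: "T \<in> ?Z" if "T \<in> P2 \<phi> \<xi> \<eta>" for T
    using that
    by (rule P2_decomposition) (use others in \<open>auto intro!: tensor.span_add\<close>)
  have 3: "T \<in> ?Z" if "T \<in> P3 \<phi> \<xi> \<eta>" for T
    using that
    by (rule P3_decomposition) (use trace_split others in \<open>auto intro!: tensor.span_add\<close>)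
  show ?thesis
  proof
    fix T :: "'v tensor3" assume "T \<in> torsion_tensors"
    then show "T \<in> ?Z"
      by (rule torsion_decomposition) (use 1 2 3 others in \<open>auto intro!: tensor.span_add\<close>)
  qed
qed

lemma perpendicular_mono: "perpendicular X Y \<Longrightarrow> X' \<subseteq> X \<Longrightarrow> Y' \<subseteq> Y \<Longrightarrow> perpendicular X' Y'"
  unfolding perpendicular_def by blast

lemma perpendicular_sym:
  assumes "perpendicular X Y" "X \<subseteq> torsion_tensors" "Y \<subseteq> torsion_tensors"
  shows "perpendicular Y X"
  using assms inner_commute torsion_tensorsD(1) unfolding perpendicular_def by (metis subsetD)

lemma orthogonal_in_complement: "perpendicular (orthogonal_complement_in g B W W0) W0"
  unfolding perpendicular_def orthogonal_complement_in_def by blast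

lemma orthogonal_within_P1:
  "sorted_wrt perpendicular [P111 \<phi> \<xi> g B, P112 \<phi> \<xi> g B, P12 \<phi> \<xi>, P131 \<phi> \<xi> g B, P132 \<phi> \<xi> g B, P14 \<phi> \<xi>]"
proof -
  have 1: "perpendicular (P111 \<phi> \<xi> g B) (P112 \<phi> \<xi> g B)" "perpendicular (P131 \<phi> \<xi> g B) (P132 \<phi> \<xi> g B)"
    unfolding P111_def P131_def by (rule orthogonal_in_complement)+
  have 2: "perpendicular (P11 \<phi> \<xi>) (P13 \<phi> \<xi>)" "perpendicular (P11 \<phi> \<xi>) (P14 \<phi> \<xi>)"
    "perpendicular (P12 \<phi> \<xi>) (P13 \<phi> \<xi>)" "perpendicular (P12 \<phi> \<xi>) (P14 \<phi> \<xi>)"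
    unfolding perpendicular_def by (simp_all add: orthogonal_P1x)
  show ?thesis
    using 1 2(4) perpendicular_mono[OF orthogonal_P11_P12 _ subset_refl]
      perpendicular_mono[OF 2(1)] perpendicular_mono[OF 2(2) _ subset_refl]
      perpendicular_mono[OF 2(3) subset_refl] perpendicular_mono[OF orthogonal_P13_P14 _ subset_refl]
    by (simp add: P_subsets)
qed

lemma orthogonal_within_P3:
  "sorted_wrt perpendicular [P311 \<phi> \<xi> \<eta> g B, P312 \<phi> \<xi> \<eta> g B, P313 \<phi> \<xi> \<eta> g B, P32 \<phi> \<xi> \<eta>, P33 \<phi> \<xi> \<eta>, P34 \<phi> \<xi> \<eta>]"
proof -
  have 1: "perpendicular (P311 \<phi> \<xi> \<eta> g B) (P313 \<phi> \<xi> \<eta> g B)" "perpendicular (P312 \<phi> \<xi> \<eta> g B) (P313 \<phi> \<xi> \<eta> g B)"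
    by (rule perpendicular_mono[OF orthogonal_in_complement _ subset_refl];
        unfold P311_def P312_def; blast)+
  show ?thesis
    using 1 orthogonal_P311_P312 orthogonal_P3x(4-6)
      orthogonal_P3x(1-3)[THEN perpendicular_mono, OF _ subset_refl]
    by (simp add: P_subsets)
qed

lemma classes_orthogonal: "sorted_wrt perpendicular classes"
proof -
  have P1: "X \<subseteq> P1 \<xi>"
    if "X \<in> set [P111 \<phi> \<xi> g B, P112 \<phi> \<xi> g B, P12 \<phi> \<xi>, P131 \<phi> \<xi> g B, P132 \<phi> \<xi> g B, P14 \<phi> \<xi>]" for X
    using that P_subsets by (simp, elim disjE; meson subset_trans)
  have P2: "X \<subseteq> P2 \<phi> \<xi> \<eta>" if "X \<in> set [P21 \<phi> \<xi> \<eta>, P22 \<phi> \<xi> \<eta>]" for X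
    using that P_subsets by auto
  have P3: "X \<subseteq> P3 \<phi> \<xi> \<eta>"
    if "X \<in> set [P311 \<phi> \<xi> \<eta> g B, P312 \<phi> \<xi> \<eta> g B, P313 \<phi> \<xi> \<eta> g B, P32 \<phi> \<xi> \<eta>, P33 \<phi> \<xi> \<eta>, P34 \<phi> \<xi> \<eta>]" for X
    using that P_subsets by (simp, elim disjE; meson subset_trans)
  have P4: "X \<subseteq> P41 \<xi> \<eta>" if "X \<in> set [P41 \<xi> \<eta>]" for X
    using that by simp
  note across = orthogonal_P1_P2[THEN perpendicular_mono, OF P1 P2] orthogonal_P1_P3[THEN perpendicular_mono, OF P1 P3]
    orthogonal_P1_P41[THEN perpendicular_mono, OF P1 P4] orthogonal_P2_P3[THEN perpendicular_mono, OF P2 P3]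
    orthogonal_P2_P41[THEN perpendicular_mono, OF P2 P4] orthogonal_P3_P41[THEN perpendicular_mono, OF P3 P4]
  have "sorted_wrt perpendicular [P21 \<phi> \<xi> \<eta>, P22 \<phi> \<xi> \<eta>]" "sorted_wrt perpendicular [P41 \<xi> \<eta>]"
    using orthogonal_P21_P22 by simp_all
  with orthogonal_within_P1 orthogonal_within_P3 show ?thesis
    unfolding classes_def sorted_wrt_append set_append
    by (intro conjI ballI) (assumption | erule UnE | (rule across, assumption, assumption))+
qed

lemma torsion_classes_orthogonal:
  assumes "i \<in> {1..15}" "j \<in> {1..15}" "i \<noteq> j"
  shows "perpendicular (torsion_class \<phi> \<xi> \<eta> g B i) (torsion_class \<phi> \<xi> \<eta> g B j)"
proof -
  have less: "perpendicular (classes ! k) (classes ! l)" if "k < l" "l < 15" for k l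
    using sorted_wrt_nth_less[OF classes_orthogonal that(1)] that(2) by (simp add: length_classes)
  have tor: "classes ! k \<subseteq> torsion_tensors" if "k < 15" for k
    using that by (intro classes_torsion nth_mem) (simp add: length_classes)
  have bounds: "i - 1 < 15" "j - 1 < 15" "i - 1 < j - 1 \<or> j - 1 < i - 1" using assms by auto
  show ?thesis
    unfolding torsion_class_nth
    using bounds(3)
  proof
    assume "i - 1 < j - 1"
    then show "perpendicular (classes ! (i - 1)) (classes ! (j - 1))" using bounds(2) by (rule less)
  next
    assume "j - 1 < i - 1"
    from less[OF this bounds(1)] show "perpendicular (classes ! (i - 1)) (classes ! (j - 1))"
      by (rule perpendicular_sym) (rule tor bounds)+
  qed
qed

lemma torsion_class_in_classes: "i \<in> {1..15} \<Longrightarrow> torsion_class \<phi> \<xi> \<eta> g B i \<in> set classes"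
  unfolding torsion_class_nth by (intro nth_mem) (auto simp: length_classes)

lemma torsion_classes_direct_sum:
  "is_direct_sum torsion_tensors {1..15} (torsion_class \<phi> \<xi> \<eta> g B)"
proof (rule orthogonal_direct_sum)
  show "tensor_inner g B X Y = 0"
    if "i \<in> {1..15}" "j \<in> {1..15}" "i \<noteq> j" "X \<in> torsion_class \<phi> \<xi> \<eta> g B i"
      "Y \<in> torsion_class \<phi> \<xi> \<eta> g B j" for i j X Y
    using torsion_classes_orthogonal[OF that(1-3)] that(4,5) unfolding perpendicular_def by blast
  have "W \<in> torsion_class \<phi> \<xi> \<eta> g B ` {1..15}" if W: "W \<in> set classes" for W
  proof -
    obtain k where "k < 15" "W = classes ! k"
      using W[unfolded in_set_conv_nth length_classes] by blast
    then have "W = torsion_class \<phi> \<xi> \<eta> g B (Suc k)" "Suc k \<in> {1..15}"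
      by (simp_all add: torsion_class_nth)
    then show ?thesis by (rule image_eqI)
  qed
  then have "\<Union>(set classes) \<subseteq> (\<Union>i\<in>{1..15}. torsion_class \<phi> \<xi> \<eta> g B i)" by blast
  then show "torsion_tensors \<subseteq> tensor.span (\<Union>i\<in>{1..15}. torsion_class \<phi> \<xi> \<eta> g B i)"
    using classes_span tensor.span_mono by (meson subset_trans)
  show "tensor.subspace (torsion_class \<phi> \<xi> \<eta> g B i)" if "i \<in> {1..15}" for i
    using that by (intro classes_subspace torsion_class_in_classes)
  show "torsion_class \<phi> \<xi> \<eta> g B i \<subseteq> torsion_tensors" if "i \<in> {1..15}" for i
    using that by (intro classes_torsion torsion_class_in_classes)
qed simp

end

theorem theorem6p24:
  fixes n :: nat
    and \<phi> :: "'v::real_vector \<Rightarrow> 'v"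
    and \<xi> :: 'v
    and \<eta> :: "'v \<Rightarrow> real"
    and g :: "'v \<Rightarrow> 'v \<Rightarrow> real"
    and B :: "'v set"
  assumes "almost_contact_B_metric n \<phi> \<xi> \<eta> g"
    and "independent B" and "span B = UNIV"
  shows "is_direct_sum torsion_tensors {1..15} (torsion_class \<phi> \<xi> \<eta> g B)
    \<and> (\<forall>i\<in>{1..15}. \<forall>j\<in>{1..15}. i \<noteq> j \<longrightarrow>
         (\<forall>T'\<in>torsion_class \<phi> \<xi> \<eta> g B i. \<forall>T''\<in>torsion_class \<phi> \<xi> \<eta> g B j.
            tensor_inner g B T' T'' = 0))
    \<and> (\<forall>a\<in>structure_group \<phi> \<xi> \<eta> g. \<forall>i\<in>{1..15}. \<forall>T\<in>torsion_class \<phi> \<xi> \<eta> g B i.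
         group_action a T \<in> torsion_class \<phi> \<xi> \<eta> g B i)"
proof -
  interpret almost_contact_basis n \<phi> \<xi> \<eta> g B
    using assms by (intro almost_contact_basis.intro almost_contact_basis_axioms.intro)
  show ?thesis
  proof (intro conjI ballI impI torsion_classes_direct_sum)
    fix i j :: nat and T' T''
    assume "i \<in> {1..15}" "j \<in> {1..15}" "i \<noteq> j"
      and "T' \<in> torsion_class \<phi> \<xi> \<eta> g B i" "T'' \<in> torsion_class \<phi> \<xi> \<eta> g B j"
    then show "tensor_inner g B T' T'' = 0"
      using torsion_classes_orthogonal unfolding perpendicular_def by blast
  next
    fix a :: "'v \<Rightarrow> 'v" and i :: nat and T
    assume "a \<in> structure_group \<phi> \<xi> \<eta> g" "i \<in> {1..15}" "T \<in> torsion_class \<phi> \<xi> \<eta> g B i"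
    then show "group_action a T \<in> torsion_class \<phi> \<xi> \<eta> g B i"
      using classes_invariant[OF torsion_class_in_classes] unfolding invariant_def by blast
  qed
qed

end
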